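(* For $\alpha\in\mathbb R$ set $$\mathfrak F_\alpha(\eta)=\int_1^\infty\tau^{-5/2-i\alpha}e^{i\eta^2\tau}\,d\tau,\qquad C_\alpha=\int_0^\infty\sigma^{-5/2-i\alpha}\big(e^{i\sigma}-1-i\sigma\big)\,d\sigma .$$ For every $\alpha\in\mathbb R$, $$\mathfrak F_\alpha\in C^{2,1}_{\mathrm{loc}}(\mathbb R)\cap C^\infty(\mathbb R\setminus\{0\}),\qquad \mathfrak F_\alpha\notin C^3(\mathbb R).$$ Moreover, near $\eta=0$, $$\mathfrak F_\alpha(\eta)=\frac1{\frac32+i\alpha}+\frac{i}{\frac12+i\alpha}\,\eta^2+C_\alpha|\eta|^{3+2i\alpha}+\eta^4G_\alpha(\eta^2),$$ where $C_\alpha\ne0$ and $G_\alpha\in C^\infty([0,\infty))$. Furthermore, $$\mathfrak F_\alpha(\eta)=\frac{ie^{i\eta^2}}{\eta^2}+O_\alpha(|\eta|^{-4}),\qquad |\eta|\to\infty .$$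
   Context: $C^{2,1}_{\mathrm{loc}}(\mathbb R)$ denotes the $C^2$ functions whose second derivative is locally Lipschitz. Complex powers: $|\eta|^{3+2i\alpha}=|\eta|^3e^{2i\alpha\log|\eta|}$ for $\eta\ne0$, with value $0$ at $\eta=0$; for $\sigma>0$, $\sigma^{z}=e^{z\log\sigma}$ with real logarithm. *)

theory Defs
  imports "HOL-Analysis.Analysis" "HOL-Library.Landau_Symbols"
begin

text \<open>
  Derivatives are taken within \<open>S\<close>: on an open set these are the ordinary derivatives, and for
  \<open>S = {0..}\<close> the derivative at \<open>0\<close> is the one-sided one. The value at \<open>x\<close> is only meaningful
  where the preceding derivative is differentiable within \<open>S\<close>, which \<open>Ck_on\<close> demands.
\<close>

primrec iter_deriv_on :: "nat \<Rightarrow> real set \<Rightarrow> (real \<Rightarrow> complex) \<Rightarrow> real \<Rightarrow> complex" where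
  "iter_deriv_on 0 S f = f"
| "iter_deriv_on (Suc k) S f = (\<lambda>x. vector_derivative (iter_deriv_on k S f) (at x within S))"

definition Ck_on :: "nat \<Rightarrow> real set \<Rightarrow> (real \<Rightarrow> complex) \<Rightarrow> bool" where
  "Ck_on k S f \<longleftrightarrow>
     (\<forall>j<k. \<forall>x\<in>S. iter_deriv_on j S f differentiable (at x within S)) \<and>
     continuous_on S (iter_deriv_on k S f)"

definition Cinf_on :: "real set \<Rightarrow> (real \<Rightarrow> complex) \<Rightarrow> bool" where
  "Cinf_on S f \<longleftrightarrow> (\<forall>k. Ck_on k S f)"

definition locally_lipschitz :: "(real \<Rightarrow> complex) \<Rightarrow> bool" where
  "locally_lipschitz f \<longleftrightarrow> (\<forall>x. \<exists>r>0. \<exists>L. L-lipschitz_on (ball x r) f)"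

definition C21_loc :: "(real \<Rightarrow> complex) \<Rightarrow> bool" where
  "C21_loc f \<longleftrightarrow> Ck_on 2 UNIV f \<and> locally_lipschitz (iter_deriv_on 2 UNIV f)"

text \<open>
  Both integrals below converge absolutely, so they are Lebesgue integrals. For real \<open>t > 0\<close> the
  complex power \<open>of_real t powr z\<close> equals \<open>exp (z * of_real (ln t))\<close>, and \<open>0 powr z = 0\<close>.
\<close>

definition frakF :: "real \<Rightarrow> real \<Rightarrow> complex" where
  "frakF \<alpha> \<eta> =
     (LINT \<tau>:{1..}|lborel.
        complex_of_real \<tau> powr (-5/2 - \<i> * of_real \<alpha>) * exp (\<i> * of_real (\<eta>\<^sup>2 * \<tau>)))"

definition coeffC :: "real \<Rightarrow> complex" where
  "coeffC \<alpha> =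
     (LINT \<sigma>:{0..}|lborel.
        complex_of_real \<sigma> powr (-5/2 - \<i> * of_real \<alpha>) *
          (exp (\<i> * of_real \<sigma>) - 1 - \<i> * of_real \<sigma>))"

end

theory Submission
  imports Defs "HOL-Complex_Analysis.Complex_Analysis"
begin

text \<open>
  Write \<open>a = -5/2 - i \<alpha>\<close>. The function in question is the generalised exponential integral
  \<open>expint a z = \<integral>\<^sub>1\<^sup>\<infinity> t\<^sup>a exp (-z t) dt\<close> on the boundary ray \<open>z = -i \<eta>\<^sup>2\<close> of the right half-plane, so
  everything follows from the behaviour of \<open>expint a\<close> near \<open>0\<close> and near infinity on
  \<open>Re z \<ge> 0\<close>.

  At the origin, subtract the Taylor polynomial \<open>1 - z t\<close> of the exponential; its integral gives the
  constant and the linear term. In what remains, substitute \<open>t = s / x\<close> for \<open>z = w x\<close> with \<open>x > 0\<close>.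
  This produces \<open>x\<close> to the power \<open>-a-1\<close> times the tail over \<open>[x, \<infinity>)\<close> of an integral that converges
  on all of \<open>(0, \<infinity>)\<close>. The full integral is the constant \<open>reg_mellin a w\<close>, and the missing
  part over \<open>(0, x)\<close> is \<open>x\<close> to the power \<open>a+1\<close> times the values at \<open>w x\<close> of an entire function with a double
  zero. Hence \<open>expint_expansion\<close>, which is exact for every \<open>x > 0\<close>, and with it the identity
  \<open>frakF_expansion\<close> on the whole line: an entire function of \<open>\<eta>\<close> plus
  \<open>C |\<eta>|\<close> to the power \<open>3 + 2i\<alpha>\<close>, where \<open>C = coeffC \<alpha>\<close>.

  All regularity statements are read off from that identity. Away from \<open>0\<close> both summands are
  restrictions of holomorphic functions. The second derivative is an entire function plus a
  multiple of \<open>|\<eta>|\<close> to the power \<open>q = 1 + 2i\<alpha>\<close>, which is Lipschitz because \<open>Re q = 1\<close>. That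
  power is even and has absolute value \<open>|\<eta>|\<close>, so it has no derivative at \<open>0\<close>; therefore the third
  derivative fails to exist there as soon as \<open>C \<noteq> 0\<close>.

  To see that \<open>C \<noteq> 0\<close>, rotate the ray of integration. For \<open>w = 1\<close> two integrations by parts reduce
  \<open>reg_mellin a 1\<close> to \<open>\<Gamma>(a + 3) / ((a + 1)(a + 2)) \<noteq> 0\<close>. The expansion for \<open>w = 1\<close> is an
  identity between functions holomorphic on \<open>Re z > 0\<close>, valid on the positive reals, hence
  everywhere in \<open>Re z > 0\<close>, and by continuity at every nonzero point of the imaginary axis.
  Comparing it there with the expansion for \<open>w = -i\<close> gives
  \<open>reg_mellin a w = w powr (-a-1) * reg_mellin a 1\<close>, which is \<open>reg_mellin_rotate\<close>.

  At infinity one integration by parts gives a recurrence from \<open>a\<close> to \<open>a - 1\<close>, and applying it twice yields the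
  leading term with a quadratic error.
\<close>

section \<open>Complex powers and integrals over half-lines\<close>

lemma norm_of_real_powr:
  assumes "x \<ge> 0"
  shows "norm (complex_of_real x powr a) = x powr Re a"
  using assms by (simp add: norm_powr_real_powr)

lemma has_vector_derivative_of_real_powr:
  assumes "x > 0"
  shows "((\<lambda>x. complex_of_real x powr a) has_vector_derivative
           a * complex_of_real x powr (a - 1)) (at x within S)"
  by (rule has_vector_derivative_real_field, rule has_field_derivative_powr)
     (use assms in \<open>auto simp: complex_nonpos_Reals_iff\<close>)

lemma continuous_on_of_real_powr [continuous_intros]:
  assumes "continuous_on S f" "\<And>x. x \<in> S \<Longrightarrow> f x > 0"
  shows "continuous_on S (\<lambda>x. complex_of_real (f x) powr a)"
  using assms by (intro continuous_on_powr_complex continuous_intros) (auto simp: less_imp_le, force)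

lemma of_real_powr_add:
  assumes "x > 0"
  shows "complex_of_real x powr (a + b) = complex_of_real x powr a * complex_of_real x powr b"
  using assms by (simp add: powr_add)

lemma of_real_powr_add_1:
  assumes "x > 0"
  shows "complex_of_real x powr (a + 1) = complex_of_real x powr a * x"
  using assms by (simp add: powr_add)

lemma of_real_powr_add_2:
  assumes "x > 0"
  shows "complex_of_real x powr (a + 2) = complex_of_real x powr a * x ^ 2"
  using assms by (simp add: powr_add)

lemma set_integrable_lborel_nonneg:
  fixes f :: "real \<Rightarrow> real"
  assumes "f integrable_on A" "\<And>x. x \<in> A \<Longrightarrow> 0 \<le> f x" "A \<in> sets borel" "f \<in> borel_measurable borel"
  shows "set_integrable lborel A f"
proof -
  have "f absolutely_integrable_on A"
    using assms by (intro nonnegative_absolutely_integrable_1) auto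
  then show ?thesis
    using assms(3,4) unfolding set_integrable_def
    by (subst (asm) integrable_completion) auto
qed

lemma set_integrable_powr_Ici:
  assumes "r < -1" "c > 0"
  shows "set_integrable lborel {c..} (\<lambda>x::real. x powr r)"
  using has_integral_powr_to_inf[OF assms]
  by (intro set_integrable_lborel_nonneg) (auto simp: integrable_on_def)

lemma set_integrable_powr_Ioc:
  assumes "r > -1" "c \<ge> 0"
  shows "set_integrable lborel {0<..c} (\<lambda>x::real. x powr r)"
  using integrable_on_powr_from_0'[OF assms]
  by (intro set_integrable_lborel_nonneg) auto

lemma set_integrable_powr_bound:
  fixes f :: "real \<Rightarrow> complex"
  assumes "set_integrable lborel A (\<lambda>x. x powr r)" "A \<in> sets borel" "continuous_on A f"
    and "\<And>x. x \<in> A \<Longrightarrow> norm (f x) \<le> B * x powr r"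
  shows "set_integrable lborel A f"
proof (rule set_integrable_bound)
  show "set_integrable lborel A (\<lambda>x. B * x powr r)"
    using assms(1) by (rule set_integrable_mult_right)
  show "set_borel_measurable lborel A f"
    using borel_measurable_continuous_on_indicator[OF assms(2,3)] by (simp add: set_borel_measurable_def)
  have "norm (f x) \<le> norm (B * x powr r)" if "x \<in> A" for x
    using assms(4)[OF that] by (smt (verit) real_norm_def)
  then show "AE x in lborel. x \<in> A \<longrightarrow> norm (f x) \<le> norm (B * x powr r)"
    by simp
qed

text \<open>
  Only limits of the primitive at the ends are assumed, because the primitives used below contain
  powers that are not differentiable at \<open>0\<close>.
\<close>
lemma set_integral_FTC_Ioi:
  fixes f F :: "real \<Rightarrow> complex"
  assumes "\<And>x. x > a \<Longrightarrow> (F has_vector_derivative f x) (at x)"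
    and "continuous_on {a<..} f"
    and "set_integrable lborel {a<..} f"
    and "(F \<longlongrightarrow> A) (at_right a)" and "(F \<longlongrightarrow> B) at_top"
  shows "(LINT x:{a<..}|lborel. f x) = B - A"
proof -
  have "(LBINT x=ereal a..\<infinity>. f x) = B - A"
  proof (rule interval_integral_FTC_integrable)
    show "isCont f x" if "ereal a < ereal x" for x
      using assms(2) that by (simp add: continuous_on_eq_continuous_at)
    show "((F \<circ> real_of_ereal) \<longlongrightarrow> A) (at_right (ereal a))"
      using assms(4) by (simp add: ereal_tendsto_simps)
    show "((F \<circ> real_of_ereal) \<longlongrightarrow> B) (at_left \<infinity>)"
      using assms(5) by (simp add: ereal_tendsto_simps)
  qed (use assms(1,3) in \<open>auto\<close>)
  then show ?thesis
    by (simp add: interval_integral_to_infinity_eq)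
qed

lemma set_integral_FTC_Ioo:
  fixes f F :: "real \<Rightarrow> complex"
  assumes "a < b"
    and "\<And>x. a < x \<Longrightarrow> x < b \<Longrightarrow> (F has_vector_derivative f x) (at x)"
    and "continuous_on {a<..<b} f"
    and "set_integrable lborel {a<..<b} f"
    and "(F \<longlongrightarrow> A) (at_right a)" and "(F \<longlongrightarrow> B) (at_left b)"
  shows "(LINT x:{a<..<b}|lborel. f x) = B - A"
proof -
  have "(LBINT x=ereal a..ereal b. f x) = B - A"
  proof (rule interval_integral_FTC_integrable)
    show "isCont f x" if "ereal a < ereal x" "ereal x < ereal b" for x
      using assms(3) that by (simp add: continuous_on_eq_continuous_at)
    show "((F \<circ> real_of_ereal) \<longlongrightarrow> A) (at_right (ereal a))"
      using assms(5) by (simp add: ereal_tendsto_simps)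
    show "((F \<circ> real_of_ereal) \<longlongrightarrow> B) (at_left (ereal b))"
      using assms(6) by (simp add: ereal_tendsto_simps)
  qed (use assms(1,2,4) in \<open>auto\<close>)
  then show ?thesis
    using assms(1) by (simp add: interval_integral_eq_integral interval_lebesgue_integral_def)
qed

lemma set_integral_Ici_eq_Ioi:
  fixes f :: "real \<Rightarrow> complex"
  shows "(LINT x:{a..}|lborel. f x) = (LINT x:{a<..}|lborel. f x)"
  by (rule set_integral_discrete_difference[of "{a}"]) auto

text \<open>
  On the right half-plane \<open>exp (-z)\<close> is a contraction, so the mean value inequality loses nothing;
  a Taylor estimate valid on the whole plane would grow exponentially in \<open>|w|\<close>.
\<close>
lemma norm_exp_minus_1_le:
  assumes "Re w \<ge> 0"
  shows "norm (1 - exp (-w)) \<le> norm w"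
proof -
  have "norm (exp (-0) - exp (-w)) \<le> 1 * norm (0 - w)"
    by (rule field_differentiable_bound[where S="{z. Re z \<ge> 0}" and f'="\<lambda>z. - exp (-z)"])
       (use assms in \<open>auto intro!: derivative_eq_intros convex_halfspace_Re_ge\<close>)
  then show ?thesis by simp
qed

text \<open>
  The derivative \<open>1 - exp (-z)\<close> is bounded by \<open>|z|\<close>, hence by \<open>|w|\<close> on the convex half-disc of radius
  \<open>|w|\<close>. This quadratic bound controls integrals near \<open>0\<close>, the linear one that follows controls
  them near infinity.
\<close>
lemma norm_exp_taylor2_le:
  assumes "Re w \<ge> 0"
  shows "norm (exp (-w) - 1 + w) \<le> norm w ^ 2"
proof -
  have "norm ((exp (-w) - 1 + w) - (exp (-0) - 1 + 0)) \<le> norm w * norm (w - 0)"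
  proof (rule field_differentiable_bound[where S="{z. Re z \<ge> 0} \<inter> cball 0 (norm w)" and f'="\<lambda>z. 1 - exp (-z)"])
    show "norm (1 - exp (-z)) \<le> norm w" if "z \<in> {z. Re z \<ge> 0} \<inter> cball 0 (norm w)" for z
      using norm_exp_minus_1_le[of z] that by simp
  qed (use assms in \<open>auto intro!: derivative_eq_intros convex_halfspace_Re_ge convex_Int\<close>)
  then show ?thesis by (simp add: power2_eq_square)
qed

lemma norm_exp_taylor2_le':
  assumes "Re w \<ge> 0"
  shows "norm (exp (-w) - 1 + w) \<le> 2 * norm w"
proof -
  have "norm (w - (1 - exp (-w))) \<le> norm w + norm (1 - exp (-w))"
    by (rule norm_triangle_ineq4)
  then show ?thesis using norm_exp_minus_1_le[OF assms] by (simp add: algebra_simps)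
qed

lemma tendsto_of_real_powr_at_right_0:
  assumes "Re a > 0"
  shows "((\<lambda>x. complex_of_real x powr a) \<longlongrightarrow> 0) (at_right 0)"
proof (rule tendsto_norm_zero_cancel)
  have "((\<lambda>x. x powr Re a) \<longlongrightarrow> 0) (at_right (0::real))"
    by (rule tendsto_eq_rhs, rule tendsto_powr') (use assms in \<open>auto intro!: tendsto_intros eventually_at_rightI[of 0 1]\<close>)
  then show "((\<lambda>x. norm (complex_of_real x powr a)) \<longlongrightarrow> 0) (at_right 0)"
    by (rule Lim_transform_eventually)
       (auto simp: norm_of_real_powr intro!: eventually_at_rightI[of 0 1])
qed

lemma tendsto_of_real_powr_at_top:
  assumes "Re a < 0"
  shows "((\<lambda>x. complex_of_real x powr a) \<longlongrightarrow> 0) at_top"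
proof (rule tendsto_norm_zero_cancel)
  have "((\<lambda>x::real. x powr Re a) \<longlongrightarrow> 0) at_top"
    by (rule tendsto_neg_powr) (use assms in \<open>auto intro: filterlim_ident\<close>)
  then show "((\<lambda>x. norm (complex_of_real x powr a)) \<longlongrightarrow> 0) at_top"
    by (rule Lim_transform_eventually)
       (auto simp: norm_of_real_powr intro!: eventually_mono[OF eventually_ge_at_top[of 0]])
qed

section \<open>The expansion of the exponential integral at the origin\<close>

definition expint :: "complex \<Rightarrow> complex \<Rightarrow> complex" where
  "expint a z = (LINT t:{1..}|lborel. complex_of_real t powr a * exp (- (z * of_real t)))"

text \<open>
  The Mellin transform of the exponential with the first two Taylor terms removed, which converges
  for \<open>-3 < Re a < -2\<close> and \<open>Re w \<ge> 0\<close>. For \<open>w = 1\<close> it is the continuation of \<open>\<Gamma>(a + 1)\<close> to this strip.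
\<close>
definition reg_mellin :: "complex \<Rightarrow> complex \<Rightarrow> complex" where
  "reg_mellin a w =
     (LINT s:{0<..}|lborel. complex_of_real s powr a * (exp (- (w * of_real s)) - 1 + w * of_real s))"

text \<open>
  Integrating the exponential series term by term, \<open>\<integral>\<^sub>0\<^sup>x s\<^sup>a (-w s)\<^sup>k / k! ds\<close> has the
  denominator \<open>k! (k + a + 1)\<close>; here \<open>k = n + 2\<close> and the factor \<open>(w x)\<^sup>2\<close> is split off.
\<close>
definition rem_coeff :: "complex \<Rightarrow> nat \<Rightarrow> complex" where
  "rem_coeff a n = (-1) ^ n / (fact (n + 2) * (of_nat n + a + 3))"

definition rem_series :: "complex \<Rightarrow> complex \<Rightarrow> complex" where
  "rem_series a z = (\<Sum>n. rem_coeff a n * z ^ n)"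

lemma rem_coeff_denominator_neq_0:
  assumes "Re a > -3"
  shows "of_nat n + a + 3 \<noteq> 0"
proof
  assume "of_nat n + a + 3 = 0"
  then have "Re (of_nat n + a + 3) = 0" by simp
  then show False using assms by simp
qed

lemma summable_rem_series:
  assumes "Re a > -3"
  shows "summable (\<lambda>n. rem_coeff a n * z ^ n)"
proof (rule summable_comparison_test')
  show "summable (\<lambda>n. (1 / (Re a + 3)) * (norm z ^ n /\<^sub>R fact n))"
    by (intro summable_mult summable_exp_generic)
  show "norm (rem_coeff a n * z ^ n) \<le> (1 / (Re a + 3)) * (norm z ^ n /\<^sub>R fact n)" for n
  proof -
    have "Re a + 3 \<le> Re (of_nat n + a + 3)" by simp
    also have "\<dots> \<le> norm (of_nat n + a + 3)" by (rule complex_Re_le_cmod)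
    finally have "Re a + 3 \<le> norm (of_nat n + a + 3)" .
    moreover have "(fact n :: real) \<le> fact (n + 2)" by (rule fact_mono) simp
    ultimately have "fact n * (Re a + 3) \<le> fact (n + 2) * norm (of_nat n + a + 3)"
      using assms by (intro mult_mono) auto
    then have "norm z ^ n / (fact (n + 2) * norm (of_nat n + a + 3)) \<le> norm z ^ n / (fact n * (Re a + 3))"
      using assms by (intro divide_left_mono mult_pos_pos) (auto simp: rem_coeff_denominator_neq_0)
    moreover have "norm (rem_coeff a n * z ^ n) = norm z ^ n / (fact (n + 2) * norm (of_nat n + a + 3))"
      by (simp add: rem_coeff_def norm_mult norm_divide norm_power del: fact_Suc)
    ultimately show ?thesis
      by (simp add: divide_inverse mult_ac)
  qed
qed

text \<open>
  Multiplying the \<open>n\<close>-th coefficient by \<open>n + a + 3\<close>, which is what \<open>z d/dz + (a + 3)\<close> does, cancels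
  the denominator and leaves the exponential series from its quadratic term on, divided by \<open>z\<^sup>2\<close>. This replaces an
  exchange of sum and integral: it exhibits a primitive of the regularised integrand.
\<close>
lemma rem_series_ODE:
  assumes "Re a > -3"
  obtains K' where "\<And>z. (rem_series a has_field_derivative K' z) (at z)"
    and "\<And>z. z\<^sup>2 * (z * K' z + (a + 3) * rem_series a z) = exp (-z) - 1 + z"
proof
  define K' where "K' = (\<lambda>z. \<Sum>n. diffs (rem_coeff a) n * z ^ n)"
  show "(rem_series a has_field_derivative K' z) (at z)" for z
    unfolding rem_series_def K'_def
    by (rule termdiffs_strong_converges_everywhere) (rule summable_rem_series[OF assms])
  show "z\<^sup>2 * (z * K' z + (a + 3) * rem_series a z) = exp (-z) - 1 + z" for z
  proof -
    have "summable (\<lambda>n. diffs (rem_coeff a) n * z ^ n)"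
      by (rule termdiff_converges_all) (rule summable_rem_series[OF assms])
    then have "(\<lambda>n. of_nat n * rem_coeff a n * z ^ (n - Suc 0)) sums K' z"
      unfolding K'_def by (rule diffs_equiv)
    then have "(\<lambda>n. z * (of_nat n * rem_coeff a n * z ^ (n - Suc 0))) sums (z * K' z)"
      by (rule sums_mult)
    moreover have "(\<lambda>n. (a + 3) * (rem_coeff a n * z ^ n)) sums ((a + 3) * rem_series a z)"
      unfolding rem_series_def by (intro sums_mult summable_sums summable_rem_series assms)
    ultimately have "(\<lambda>n. z * (of_nat n * rem_coeff a n * z ^ (n - Suc 0)) + (a + 3) * (rem_coeff a n * z ^ n))
        sums (z * K' z + (a + 3) * rem_series a z)"
      by (rule sums_add)
    then have "(\<lambda>n. z\<^sup>2 * (z * (of_nat n * rem_coeff a n * z ^ (n - Suc 0)) + (a + 3) * (rem_coeff a n * z ^ n)))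
        sums (z\<^sup>2 * (z * K' z + (a + 3) * rem_series a z))"
      by (rule sums_mult)
    moreover have "z\<^sup>2 * (z * (of_nat n * rem_coeff a n * z ^ (n - Suc 0)) + (a + 3) * (rem_coeff a n * z ^ n))
        = (-z) ^ (n + 2) /\<^sub>R fact (n + 2)" for n
    proof -
      have "z * (of_nat n * rem_coeff a n * z ^ (n - Suc 0)) = of_nat n * rem_coeff a n * z ^ n"
        by (cases n) auto
      then have "z\<^sup>2 * (z * (of_nat n * rem_coeff a n * z ^ (n - Suc 0)) + (a + 3) * (rem_coeff a n * z ^ n))
          = z ^ (n + 2) * ((of_nat n + a + 3) * rem_coeff a n)"
        by (simp add: power_add algebra_simps power2_eq_square)
      also have "(of_nat n + a + 3) * rem_coeff a n = (-1) ^ n / fact (n + 2)"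
        using rem_coeff_denominator_neq_0[OF assms, of n] by (simp add: rem_coeff_def del: fact_Suc)
      also have "z ^ (n + 2) * ((-1) ^ n / fact (n + 2)) = (-z) ^ (n + 2) /\<^sub>R fact (n + 2)"
        by (simp add: scaleR_conv_of_real power_minus[of z] divide_inverse mult_ac del: fact_Suc)
      finally show ?thesis .
    qed
    ultimately have "(\<lambda>n. (-z) ^ (n + 2) /\<^sub>R fact (n + 2)) sums (z\<^sup>2 * (z * K' z + (a + 3) * rem_series a z))"
      by simp
    moreover have "(\<lambda>n. (-z) ^ (n + 2) /\<^sub>R fact (n + 2)) sums (exp (-z) - (\<Sum>i<2. (-z) ^ i /\<^sub>R fact i))"
      by (rule sums_split_initial_segment) (rule exp_converges)
    ultimately show ?thesis
      by (auto simp: numeral_2_eq_2 dest: sums_unique2)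
  qed
qed

lemma rem_series_holomorphic:
  assumes "Re a > -3"
  shows "rem_series a holomorphic_on S"
  by (rule rem_series_ODE[OF assms]) (auto simp: holomorphic_on_def field_differentiable_def intro: has_field_derivative_at_within)

lemma continuous_on_reg_mellin_integrand:
  "continuous_on {0<..} (\<lambda>s. complex_of_real s powr a * (exp (- (w * of_real s)) - 1 + w * of_real s))"
  by (intro continuous_intros) auto

text \<open>
  Near \<open>0\<close> the quadratic bound on the exponential remainder needs \<open>Re a > -3\<close>, near infinity the
  linear bound needs \<open>Re a < -2\<close>.
\<close>
lemma set_integrable_reg_mellin:
  assumes "-3 < Re a" "Re a < -2" "Re w \<ge> 0"
  shows "set_integrable lborel {0<..}
           (\<lambda>s. complex_of_real s powr a * (exp (- (w * of_real s)) - 1 + w * of_real s))"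
    (is "set_integrable _ _ ?f")
proof -
  have "set_integrable lborel {0<..1} ?f"
  proof (rule set_integrable_powr_bound)
    show "set_integrable lborel {0<..1} (\<lambda>s::real. s powr (Re a + 2))"
      using assms by (intro set_integrable_powr_Ioc) auto
    show "norm (?f s) \<le> norm w ^ 2 * s powr (Re a + 2)" if "s \<in> {0<..1}" for s
    proof -
      have "norm (?f s) \<le> s powr Re a * norm (w * of_real s) ^ 2"
        unfolding norm_mult using that assms
        by (intro mult_mono order.trans[OF norm_exp_taylor2_le]) (auto simp: norm_of_real_powr norm_mult)
      also have "\<dots> = norm w ^ 2 * s powr (Re a + 2)"
        using that by (simp add: powr_add norm_mult power_mult_distrib)
      finally show ?thesis .
    qed
  qed (auto intro: continuous_on_subset[OF continuous_on_reg_mellin_integrand])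
  moreover have "set_integrable lborel {1..} ?f"
  proof (rule set_integrable_powr_bound)
    show "set_integrable lborel {1..} (\<lambda>s::real. s powr (Re a + 1))"
      using assms by (intro set_integrable_powr_Ici) auto
    show "norm (?f s) \<le> (2 * norm w) * s powr (Re a + 1)" if "s \<in> {1..}" for s
    proof -
      have "norm (?f s) \<le> s powr Re a * (2 * norm (w * of_real s))"
        unfolding norm_mult using that assms
        by (intro mult_mono order.trans[OF norm_exp_taylor2_le']) (auto simp: norm_of_real_powr norm_mult)
      also have "\<dots> = (2 * norm w) * s powr (Re a + 1)"
        using that by (simp add: powr_add norm_mult)
      finally show ?thesis .
    qed
  qed (auto intro: continuous_on_subset[OF continuous_on_reg_mellin_integrand])
  moreover have "{0<..(1::real)} \<union> {1..} = {0<..}" by auto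
  ultimately show ?thesis
    using set_integrable_Un[of lborel "{0<..1}" ?f "{1..}"] by simp
qed

text \<open>
  By the differential equation for \<open>rem_series a\<close>, the right-hand side, as a function of \<open>x\<close>, is a
  primitive of the integrand. It vanishes at \<open>0\<close> because \<open>Re (a + 3) > 0\<close>.
\<close>
lemma reg_mellin_initial_part:
  assumes "-3 < Re a" "Re a < -2" "Re w \<ge> 0" "x > 0"
  shows "(LINT s:{0<..<x}|lborel. complex_of_real s powr a * (exp (- (w * of_real s)) - 1 + w * of_real s))
         = of_real x powr (a + 3) * w\<^sup>2 * rem_series a (w * of_real x)"
proof -
  obtain K' where K': "\<And>z. (rem_series a has_field_derivative K' z) (at z)"
    and ode: "\<And>z. z\<^sup>2 * (z * K' z + (a + 3) * rem_series a z) = exp (-z) - 1 + z"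
    using rem_series_ODE[OF assms(1)] by blast
  define F where "F = (\<lambda>s. of_real s powr (a + 3) * w\<^sup>2 * rem_series a (w * of_real s))"
  have deriv: "((\<lambda>s. rem_series a (w * of_real s)) has_vector_derivative w * K' (w * of_real s)) (at s)" for s
    by (rule has_vector_derivative_real_field, rule DERIV_cong, rule DERIV_chain'[OF _ K'])
       (auto intro!: derivative_eq_intros)
  then have cont: "isCont (\<lambda>s. rem_series a (w * of_real s)) s" for s
    by (rule has_vector_derivative_continuous)
  have F': "(F has_vector_derivative
      complex_of_real s powr a * (exp (- (w * of_real s)) - 1 + w * of_real s)) (at s)" if "s > 0" for s
  proof -
    have "(F has_vector_derivative
        (of_real s powr (a + 3) * w\<^sup>2 * (w * K' (w * of_real s)) +
         ((a + 3) * of_real s powr (a + 3 - 1)) * w\<^sup>2 * rem_series a (w * of_real s))) (at s)"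
      unfolding F_def
      by (intro has_vector_derivative_mult has_vector_derivative_mult_left has_vector_derivative_of_real_powr that deriv)
    also have "a + 3 - 1 = a + 2" by simp
    also have "of_real s powr (a + 3) * w\<^sup>2 * (w * K' (w * of_real s)) +
         ((a + 3) * of_real s powr (a + 2)) * w\<^sup>2 * rem_series a (w * of_real s)
       = of_real s powr a * ((w * of_real s)\<^sup>2 * (w * of_real s * K' (w * of_real s) + (a + 3) * rem_series a (w * of_real s)))"
      using that by (simp add: of_real_powr_add[OF that] power_mult_distrib algebra_simps power2_eq_square power3_eq_cube)
    finally show ?thesis by (simp add: ode)
  qed
  have "(LINT s:{0<..<x}|lborel. complex_of_real s powr a * (exp (- (w * of_real s)) - 1 + w * of_real s)) = F x - 0"
  proof (rule set_integral_FTC_Ioo)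
    show "(F \<longlongrightarrow> 0) (at_right 0)"
    proof -
      have "((\<lambda>s. rem_series a (w * of_real s)) \<longlongrightarrow> rem_series a (w * of_real 0)) (at_right 0)"
        using cont[of 0] unfolding isCont_def by (rule tendsto_within_subset) auto
      then have "(F \<longlongrightarrow> 0 * w\<^sup>2 * rem_series a (w * of_real 0)) (at_right 0)"
        unfolding F_def using assms
        by (intro tendsto_mult tendsto_const tendsto_of_real_powr_at_right_0) auto
      then show ?thesis by simp
    qed
    show "(F \<longlongrightarrow> F x) (at_left x)"
      using has_vector_derivative_continuous[OF F'[OF assms(4)]]
      unfolding isCont_def by (rule tendsto_within_subset) auto
    show "set_integrable lborel {0<..<x} (\<lambda>s. complex_of_real s powr a * (exp (- (w * of_real s)) - 1 + w * of_real s))"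
      by (rule set_integrable_subset[OF set_integrable_reg_mellin]) (use assms in auto)
  qed (use assms F' in \<open>auto intro: continuous_on_subset[OF continuous_on_reg_mellin_integrand]\<close>)
  then show ?thesis by (simp add: F_def)
qed

lemma set_integrable_expint:
  assumes "Re a < -1" "Re z \<ge> 0"
  shows "set_integrable lborel {1..} (\<lambda>t. complex_of_real t powr a * exp (- (z * of_real t)))"
proof (rule set_integrable_powr_bound[where B=1])
  show "set_integrable lborel {1..} (\<lambda>s::real. s powr Re a)"
    using assms by (intro set_integrable_powr_Ici) auto
  show "norm (complex_of_real t powr a * exp (- (z * of_real t))) \<le> 1 * t powr Re a" if "t \<in> {1..}" for t
    using that assms by (auto simp: norm_mult norm_of_real_powr mult_left_le)
qed (auto intro!: continuous_intros)

lemma set_integrable_of_real_powr_Ici: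
  assumes "Re a < -1"
  shows "set_integrable lborel {1..} (\<lambda>t. complex_of_real t powr a)"
  using set_integrable_expint[OF assms, of 0] by simp

lemma set_integral_of_real_powr_Ici:
  assumes "Re a < -1"
  shows "(LINT t:{1..}|lborel. complex_of_real t powr a) = - 1 / (a + 1)"
proof -
  have a: "a + 1 \<noteq> 0" using assms by (auto simp: complex_eq_iff)
  have "(LINT t:{1<..}|lborel. complex_of_real t powr a) = 0 - of_real 1 powr (a + 1) / (a + 1)"
  proof (rule set_integral_FTC_Ioi)
    have "((\<lambda>t. complex_of_real t powr (a + 1) / (a + 1)) has_vector_derivative of_real x powr a) (at x)"
      if "x > 0" for x
      using has_vector_derivative_divide[OF has_vector_derivative_of_real_powr[OF that, of "a + 1"], of "a + 1"] a
      by simp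
    then show "((\<lambda>t. complex_of_real t powr (a + 1) / (a + 1)) has_vector_derivative of_real x powr a) (at x)"
      if "x > 1" for x using that by simp
    show "((\<lambda>t. complex_of_real t powr (a + 1) / (a + 1)) \<longlongrightarrow> 0) at_top"
      using tendsto_of_real_powr_at_top[of "a + 1"] assms by (auto intro!: tendsto_divide_zero)
    have "isCont (\<lambda>t. complex_of_real t powr (a + 1)) 1"
      by (rule has_vector_derivative_continuous, rule has_vector_derivative_of_real_powr) simp
    then have "((\<lambda>t. complex_of_real t powr (a + 1)) \<longlongrightarrow> of_real 1 powr (a + 1)) (at_right 1)"
      unfolding isCont_def by (rule tendsto_within_subset) auto
    then show "((\<lambda>t. complex_of_real t powr (a + 1) / (a + 1)) \<longlongrightarrow> of_real 1 powr (a + 1) / (a + 1)) (at_right 1)"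
      by (rule tendsto_divide[OF _ tendsto_const a])
    show "set_integrable lborel {1<..} (\<lambda>t. complex_of_real t powr a)"
      by (rule set_integrable_subset[OF set_integrable_of_real_powr_Ici[OF assms]]) auto
  qed (auto intro!: continuous_intros)
  then show ?thesis by (simp add: set_integral_Ici_eq_Ioi)
qed

text \<open>
  With \<open>t = s / x\<close> the integral of the regularised integrand over \<open>[1, \<infinity>)\<close> becomes a tail of
  \<open>reg_mellin a w\<close>. The parameter \<open>w\<close> is kept apart from the scale \<open>x\<close> so that one
  statement serves both the positive reals (\<open>w = 1\<close>) and the imaginary axis (\<open>w = -i\<close>).
\<close>
lemma expint_expansion:
  assumes "-3 < Re a" "Re a < -2" "Re w \<ge> 0" "x > 0"
  shows "expint a (w * of_real x) =
           - 1 / (a + 1) + w * of_real x / (a + 2)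
           + of_real x powr (- a - 1) * reg_mellin a w
           - (w * of_real x)\<^sup>2 * rem_series a (w * of_real x)"
proof -
  define f where "f = (\<lambda>s. complex_of_real s powr a * (exp (- (w * of_real s)) - 1 + w * of_real s))"
  have f: "set_integrable lborel {0<..} f"
    unfolding f_def by (rule set_integrable_reg_mellin[OF assms(1-3)])
  have fx: "set_integrable lborel {x..} f"
    by (rule set_integrable_subset[OF f]) (use assms in auto)
  have "reg_mellin a w = (LINT s:{0<..<x} \<union> {x..}|lborel. f s)"
    unfolding reg_mellin_def f_def by (rule arg_cong2[where f="set_lebesgue_integral lborel"]) (use assms in auto)
  also have "\<dots> = (LINT s:{0<..<x}|lborel. f s) + (LINT s:{x..}|lborel. f s)"
    by (rule set_integral_Un) (auto intro: set_integrable_subset[OF f] fx)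
  finally have tail: "(LINT s:{x..}|lborel. f s) =
      reg_mellin a w - of_real x powr (a + 3) * w\<^sup>2 * rem_series a (w * of_real x)"
    using reg_mellin_initial_part[OF assms] by (simp add: f_def)
  have scale: "f (x * t) = of_real x powr a * (of_real t powr a * (exp (- (w * of_real x * of_real t)) - 1 + w * of_real x * of_real t))"
    if "t \<ge> 1" for t
    using that assms(4) by (simp add: f_def powr_times_real mult_ac)
  have ind: "indicator {x..} (x * t) = (indicator {1..} t :: real)" for t
    using assms(4) by (simp add: indicator_def)
  have eq: "indicator {x..} (0 + x * t) *\<^sub>R f (0 + x * t) = of_real x powr a *
     (indicator {1..} t *\<^sub>R (of_real t powr a * (exp (- (w * of_real x * of_real t)) - 1 + w * of_real x * of_real t)))" for t
    using scale[of t] ind[of t] by (cases "t \<ge> 1") auto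
  have "(LINT s:{x..}|lborel. f s) = \<bar>x\<bar> *\<^sub>R (\<integral>t. indicator {x..} (0 + x * t) *\<^sub>R f (0 + x * t) \<partial>lborel)"
    unfolding set_lebesgue_integral_def by (rule lborel_integral_real_affine) (use assms in auto)
  also have "\<dots> = of_real x powr (a + 1) *
      (LINT t:{1..}|lborel. of_real t powr a * (exp (- (w * of_real x * of_real t)) - 1 + w * of_real x * of_real t))"
    unfolding eq set_lebesgue_integral_def using assms(4)
    by (simp add: of_real_powr_add_1 scaleR_conv_of_real)
  finally have tail': "(LINT s:{x..}|lborel. f s) = of_real x powr (a + 1) *
      (LINT t:{1..}|lborel. of_real t powr a * (exp (- (w * of_real x * of_real t)) - 1 + w * of_real x * of_real t))"
      (is "_ = _ * ?J") .
  have i1: "set_integrable lborel {1..} (\<lambda>t. complex_of_real t powr a)"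
    using assms by (intro set_integrable_of_real_powr_Ici) auto
  have i2: "set_integrable lborel {1..} (\<lambda>t. w * of_real x * complex_of_real t powr (a + 1))"
    using assms by (intro set_integrable_mult_right set_integrable_of_real_powr_Ici) auto
  have i3: "set_integrable lborel {1..} (\<lambda>t. complex_of_real t powr a * exp (- (w * of_real x * of_real t)))"
    using assms by (intro set_integrable_expint) auto
  have "?J = (LINT t:{1..}|lborel. (of_real t powr a * exp (- (w * of_real x * of_real t)) - of_real t powr a)
        + w * of_real x * complex_of_real t powr (a + 1))"
    by (rule set_lebesgue_integral_cong) (auto simp: algebra_simps powr_add)
  also have "\<dots> = expint a (w * of_real x) + 1 / (a + 1) - w * of_real x / (a + 2)"
    using i1 i2 i3 assms
    by (simp add: set_integral_add set_integral_diff set_integral_of_real_powr_Ici expint_def mult.assoc add.assoc)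
  finally have J: "?J = expint a (w * of_real x) + 1 / (a + 1) - w * of_real x / (a + 2)" .
  have p0: "complex_of_real x powr (a + 1) \<noteq> 0" using assms by simp
  have p: "of_real x powr (- a - 1) = inverse (complex_of_real x powr (a + 1))"
    by (simp add: powr_minus[symmetric])
  have "of_real x powr (a + 3) = complex_of_real x powr (a + 1) * (of_real x)\<^sup>2"
    using of_real_powr_add_2[OF assms(4), of "a + 1"] by (simp add: add.assoc)
  with tail tail' J have "complex_of_real x powr (a + 1) * (expint a (w * of_real x) + 1 / (a + 1) - w * of_real x / (a + 2))
     = reg_mellin a w - complex_of_real x powr (a + 1) * (of_real x)\<^sup>2 * w\<^sup>2 * rem_series a (w * of_real x)"
    by simp
  then have "expint a (w * of_real x) + 1 / (a + 1) - w * of_real x / (a + 2) =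
     of_real x powr (- a - 1) * reg_mellin a w - (w * of_real x)\<^sup>2 * rem_series a (w * of_real x)"
    unfolding p using p0 by (simp add: field_simps power_mult_distrib)
  then show ?thesis by (simp add: algebra_simps)
qed

section \<open>The regularised Mellin transform does not vanish\<close>

lemma Gamma_set_integral:
  assumes "Re z > 0"
  shows "set_integrable lborel {0<..} (\<lambda>t. complex_of_real t powr (z - 1) * exp (- of_real t))"
    and "(LINT t:{0<..}|lborel. complex_of_real t powr (z - 1) * exp (- of_real t)) = Gamma z"
proof -
  have eq: "complex_of_real t powr (z - 1) / of_real (exp t) = of_real t powr (z - 1) * exp (- of_real t)" for t
    by (simp add: exp_minus exp_of_real divide_inverse)
  have "(\<lambda>t. complex_of_real t powr (z - 1) * exp (- of_real t)) absolutely_integrable_on {0<..}"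
    using absolutely_integrable_Gamma_integral[OF assms, of 1] by (simp add: eq)
  moreover have "(\<lambda>t. indicator {0<..} t *\<^sub>R (complex_of_real t powr (z - 1) * exp (- of_real t))) \<in> borel_measurable borel"
    by (intro borel_measurable_continuous_on_indicator continuous_intros) auto
  ultimately show i: "set_integrable lborel {0<..} (\<lambda>t. complex_of_real t powr (z - 1) * exp (- of_real t))"
    unfolding set_integrable_def by (subst (asm) integrable_completion) auto
  have "((\<lambda>t. complex_of_real t powr (z - 1) * exp (- of_real t)) has_integral Gamma z) {0<..}"
    using Gamma_integral_complex'[OF assms] by (simp add: eq)
  then show "(LINT t:{0<..}|lborel. complex_of_real t powr (z - 1) * exp (- of_real t)) = Gamma z"
    using set_borel_integral_eq_integral(2)[OF i] by (simp add: integral_unique)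
qed

text \<open>
  Integration by parts twice; the boundary terms vanish at both ends because
  \<open>-3 < Re a < -2\<close>.
\<close>
lemma reg_mellin_1:
  assumes "-3 < Re a" "Re a < -2"
  shows "(a + 1) * (a + 2) * reg_mellin a 1 = Gamma (a + 3)"
proof -
  define \<psi> where "\<psi> = (\<lambda>s. exp (- complex_of_real s) - 1 + of_real s)"
  \<comment> \<open>The boundary terms of both integrations by parts, multiplied by \<open>(a + 1) (a + 2)\<close>.\<close>
  define F where "F = (\<lambda>s. (a + 2) * (of_real s powr (a + 1) * \<psi> s)
    - of_real s powr (a + 2) * (1 - exp (- complex_of_real s)))"
  define g where "g = (\<lambda>s. (a + 1) * (a + 2) * (of_real s powr a * \<psi> s))"
  define h where "h = (\<lambda>s. complex_of_real s powr (a + 2) * exp (- complex_of_real s))"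
  have g: "set_integrable lborel {0<..} g"
    using set_integrable_reg_mellin[OF assms, of 1] by (auto simp: g_def \<psi>_def)
  have h: "set_integrable lborel {0<..} h" "(LINT t:{0<..}|lborel. h t) = Gamma (a + 3)"
    using Gamma_set_integral[of "a + 3"] assms by (simp_all add: h_def add.commute[of 2 a])
  have dexp: "((\<lambda>s. exp (- complex_of_real s)) has_vector_derivative - exp (- complex_of_real s)) (at s)" for s
    by (rule has_vector_derivative_real_field) (auto intro!: derivative_eq_intros)
  have d\<psi>: "(\<psi> has_vector_derivative 1 - exp (- complex_of_real s)) (at s)" for s
    unfolding \<psi>_def by (rule has_vector_derivative_real_field) (auto intro!: derivative_eq_intros)
  have dF: "(F has_vector_derivative g s - h s) (at s)" if "s > 0" for s
  proof -
    have "(F has_vector_derivative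
        (a + 2) * (of_real s powr (a + 1) * (1 - exp (- complex_of_real s))
          + (a + 1) * of_real s powr (a + 1 - 1) * \<psi> s)
        - (of_real s powr (a + 2) * (0 - - exp (- complex_of_real s))
          + (a + 2) * of_real s powr (a + 2 - 1) * (1 - exp (- complex_of_real s)))) (at s)"
      unfolding F_def
      by (intro has_vector_derivative_mult has_vector_derivative_mult_right has_vector_derivative_of_real_powr
          has_vector_derivative_diff has_vector_derivative_const dexp d\<psi> that)
    moreover have "a + 2 - 1 = a + 1" by simp
    ultimately show ?thesis
      by (simp add: g_def h_def algebra_simps)
  qed
  have \<psi>: "norm (\<psi> s) \<le> s ^ 2" "norm (\<psi> s) \<le> 2 * s" "norm (1 - exp (- complex_of_real s)) \<le> s"
       "norm (1 - exp (- complex_of_real s)) \<le> 2" if "s \<ge> 0" for s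
  proof -
    have e: "norm (exp (- complex_of_real s)) \<le> 1" using that by simp
    have "norm (1 - exp (- complex_of_real s)) \<le> norm (1::complex) + norm (exp (- complex_of_real s))"
      by (rule norm_triangle_ineq4)
    then show "norm (1 - exp (- complex_of_real s)) \<le> 2"
      using e by (simp only: norm_one)
  qed (use that norm_exp_taylor2_le[of "of_real s"] norm_exp_taylor2_le'[of "of_real s"]
      norm_exp_minus_1_le[of "of_real s"] in \<open>auto simp: \<psi>_def\<close>)
  define C where "C = norm (a + 2) * 2 + 2"
  have F: "norm (F s) \<le> norm (a + 2) * (norm (complex_of_real s powr (a + 1)) * norm (\<psi> s))
     + norm (complex_of_real s powr (a + 2)) * norm (1 - exp (- complex_of_real s))" for s
    unfolding F_def using norm_triangle_ineq4 by (metis norm_mult)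
  have N: "norm (complex_of_real s powr (a + 1)) = s powr Re a * s"
      "norm (complex_of_real s powr (a + 2)) = s powr Re a * s ^ 2"
      "norm (complex_of_real s powr (a + 3)) = s powr Re a * s ^ 3" if "s > 0" for s
    using that powr_add[of s "Re a" 1] powr_add[of s "Re a" 2] powr_add[of s "Re a" 3]
    by (simp_all add: norm_of_real_powr)
  have F0: "norm (F s) \<le> C * norm (complex_of_real s powr (a + 3))" if "s > 0" for s
  proof -
    have "norm (F s) \<le> norm (a + 2) * (norm (complex_of_real s powr (a + 1)) * s ^ 2)
       + norm (complex_of_real s powr (a + 2)) * s"
      using \<psi>[of s] that by (intro order.trans[OF F] add_mono mult_left_mono) auto
    also have "\<dots> = (norm (a + 2) + 1) * norm (complex_of_real s powr (a + 3))"
      unfolding N[OF that] by (simp add: algebra_simps power2_eq_square power3_eq_cube)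
    also have "\<dots> \<le> C * norm (complex_of_real s powr (a + 3))"
      by (intro mult_right_mono) (auto simp: C_def)
    finally show ?thesis .
  qed
  have F1: "norm (F s) \<le> C * norm (complex_of_real s powr (a + 2))" if "s > 0" for s
  proof -
    have "norm (F s) \<le> norm (a + 2) * (norm (complex_of_real s powr (a + 1)) * (2 * s))
       + norm (complex_of_real s powr (a + 2)) * 2"
      using \<psi>[of s] that by (intro order.trans[OF F] add_mono mult_left_mono) auto
    also have "\<dots> = C * norm (complex_of_real s powr (a + 2))"
      unfolding N[OF that] C_def by (simp add: algebra_simps power2_eq_square)
    finally show ?thesis .
  qed
  have "(LINT s:{0<..}|lborel. g s - h s) = 0 - 0"
  proof (rule set_integral_FTC_Ioi[where F=F])
    show "continuous_on {0<..} (\<lambda>s. g s - h s)"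
      unfolding g_def h_def \<psi>_def by (intro continuous_intros) auto
    show "set_integrable lborel {0<..} (\<lambda>s. g s - h s)"
      using g h by (intro set_integral_diff)
    show "(F \<longlongrightarrow> 0) (at_right 0)"
    proof (rule Lim_null_comparison)
      show "((\<lambda>s. C * norm (complex_of_real s powr (a + 3))) \<longlongrightarrow> 0) (at_right 0)"
        using assms by (intro tendsto_mult_right_zero tendsto_norm_zero tendsto_of_real_powr_at_right_0) auto
    qed (use F0 in \<open>auto intro!: eventually_at_rightI[of 0 1]\<close>)
    show "(F \<longlongrightarrow> 0) at_top"
    proof (rule Lim_null_comparison)
      show "((\<lambda>s. C * norm (complex_of_real s powr (a + 2))) \<longlongrightarrow> 0) at_top"
        using assms by (intro tendsto_mult_right_zero tendsto_norm_zero tendsto_of_real_powr_at_top) auto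
    qed (use F1 in \<open>auto intro!: eventually_mono[OF eventually_gt_at_top[of 0]]\<close>)
  qed (use dF in auto)
  then have "(LINT s:{0<..}|lborel. g s) = Gamma (a + 3)"
    using g h by (simp add: set_integral_diff)
  moreover have "(LINT s:{0<..}|lborel. g s) = (a + 1) * (a + 2) * reg_mellin a 1"
    unfolding g_def reg_mellin_def \<psi>_def by simp
  ultimately show ?thesis by simp
qed

lemma norm_set_integral_Ici_le:
  fixes f :: "real \<Rightarrow> complex"
  assumes "r < -1" "c > 0" "set_integrable lborel {c..} f"
    and "\<And>t. t \<ge> c \<Longrightarrow> norm (f t) \<le> t powr r"
  shows "norm (LINT t:{c..}|lborel. f t) \<le> - (c powr (r + 1)) / (r + 1)"
proof -
  have i: "set_integrable lborel {c..} (\<lambda>t::real. t powr r)"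
    by (rule set_integrable_powr_Ici[OF assms(1,2)])
  have "norm (LINT t:{c..}|lborel. f t) \<le> (LINT t:{c..}|lborel. norm (f t))"
    using assms(3) by (rule set_integral_norm_bound)
  also have "\<dots> \<le> (LINT t:{c..}|lborel. t powr r)"
    using assms(4) by (intro set_integral_mono set_integrable_norm assms(3) i) auto
  also have "\<dots> = - (c powr (r + 1)) / (r + 1)"
    using set_borel_integral_eq_integral(2)[OF i] has_integral_powr_to_inf[OF assms(1,2)]
    by (simp add: integral_unique)
  finally show ?thesis .
qed

text \<open>
  The integrals over \<open>[1, n + 1]\<close> are entire, and they converge uniformly on the closed half-plane,
  because there the integrand is dominated by the integrable function \<open>t\<close> to the power \<open>Re a\<close>. Continuity up to the imaginary axis is what lets the
  analytic continuation reach the oscillatory case.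
\<close>
lemma expint_holomorphic_continuous:
  assumes "Re a < -1"
  shows expint_holomorphic: "expint a holomorphic_on {z. Re z > 0}"
    and expint_continuous: "continuous_on {z. Re z \<ge> 0} (expint a)"
proof -
  define f where "f = (\<lambda>n z. integral (cbox 1 (real n + 1)) (\<lambda>t. complex_of_real t powr a * exp (- (z * of_real t))))"
  have hol: "f n holomorphic_on S" for n S
  proof -
    have "f n holomorphic_on UNIV"
      unfolding f_def
    proof (rule leibniz_rule_holomorphic)
      show "((\<lambda>z. of_real t powr a * exp (- (z * of_real t))) has_field_derivative
          of_real t powr a * (exp (- (z * of_real t)) * - of_real t)) (at z within UNIV)" for z and t :: real
        by (auto intro!: derivative_eq_intros)
      show "(\<lambda>t. complex_of_real t powr a * exp (- (z * of_real t))) integrable_on cbox 1 (real n + 1)" for z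
        by (intro integrable_continuous continuous_intros) auto
      show "continuous_on (UNIV \<times> cbox 1 (real n + 1))
         (\<lambda>(z, t). complex_of_real t powr a * (exp (- (z * of_real t)) * - of_real t))"
        unfolding split_beta by (intro continuous_intros) auto
    qed auto
    then show ?thesis by (rule holomorphic_on_subset) auto
  qed
  have unif: "uniform_limit {z. Re z \<ge> 0} f (expint a) sequentially"
  proof (rule uniform_limitI)
    fix e :: real assume "e > 0"
    have "((\<lambda>x::real. x powr (Re a + 1)) \<longlongrightarrow> 0) at_top"
      using assms by (intro tendsto_neg_powr filterlim_ident) auto
    moreover have "filterlim (\<lambda>n. real n + 1) at_top sequentially"
      using filterlim_tendsto_add_at_top[OF tendsto_const filterlim_real_sequentially, of 1]
      by (simp add: add.commute)
    ultimately have "(\<lambda>n. - ((real n + 1) powr (Re a + 1)) / (Re a + 1)) \<longlonglongrightarrow> - 0 / (Re a + 1)"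
      using assms by (intro tendsto_divide tendsto_minus tendsto_const) (auto intro: filterlim_compose)
    then have "\<forall>\<^sub>F n in sequentially. - ((real n + 1) powr (Re a + 1)) / (Re a + 1) < e"
      using \<open>e > 0\<close> by (intro order_tendstoD(2)) auto
    then show "\<forall>\<^sub>F n in sequentially. \<forall>z\<in>{z. Re z \<ge> 0}. dist (f n z) (expint a z) < e"
    proof eventually_elim
      case (elim n)
      show ?case
      proof
        fix z assume z: "z \<in> {z. Re z \<ge> 0}"
        let ?h = "\<lambda>t. complex_of_real t powr a * exp (- (z * of_real t))"
        have i: "set_integrable lborel {1..} ?h"
          using set_integrable_expint[OF assms] z by simp
        have i1: "set_integrable lborel {1..<real n + 1} ?h"
          by (rule set_integrable_subset[OF i]) auto
        have i1': "set_integrable lborel {1..real n + 1} ?h"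
          by (rule set_integrable_subset[OF i]) auto
        have i2: "set_integrable lborel {real n + 1..} ?h"
          by (rule set_integrable_subset[OF i]) auto
        have "expint a z = (LINT t:{1..<real n + 1} \<union> {real n + 1..}|lborel. ?h t)"
          unfolding expint_def by (rule arg_cong2[where f="set_lebesgue_integral lborel"]) auto
        also have "\<dots> = (LINT t:{1..<real n + 1}|lborel. ?h t) + (LINT t:{real n + 1..}|lborel. ?h t)"
          by (rule set_integral_Un[OF _ i1 i2]) auto
        also have "(LINT t:{1..<real n + 1}|lborel. ?h t) = (LINT t:{1..real n + 1}|lborel. ?h t)"
          by (rule set_integral_discrete_difference[of "{real n + 1}"]) auto
        also have "\<dots> = f n z"
          using set_borel_integral_eq_integral(2)[OF i1'] by (simp add: f_def)
        finally have "dist (f n z) (expint a z) = norm (LINT t:{real n + 1..}|lborel. ?h t)"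
          by (simp add: dist_norm)
        also have "\<dots> \<le> - ((real n + 1) powr (Re a + 1)) / (Re a + 1)"
          using z by (intro norm_set_integral_Ici_le assms i2) (auto simp: norm_mult norm_of_real_powr mult_left_le)
        also have "\<dots> < e" by (rule elim)
        finally show "dist (f n z) (expint a z) < e" .
      qed
    qed
  qed
  show "continuous_on {z. Re z \<ge> 0} (expint a)"
    by (rule uniform_limit_theorem[OF _ unif])
       (auto intro!: always_eventually holomorphic_on_imp_continuous_on hol)
  show "expint a holomorphic_on {z. Re z > 0}"
  proof (rule holomorphic_uniform_sequence[OF open_halfspace_Re_gt hol])
    fix z assume "z \<in> {z. Re z > 0}"
    then obtain d where d: "d > 0" "cball z d \<subseteq> {z. Re z > 0}"
      using open_contains_cball[of "{z. Re z > 0}"] open_halfspace_Re_gt by blast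
    then have "uniform_limit (cball z d) f (expint a) sequentially"
      by (intro uniform_limit_on_subset[OF unif]) auto
    with d show "\<exists>d>0. cball z d \<subseteq> {z. Re z > 0} \<and> uniform_limit (cball z d) f (expint a) sequentially"
      by blast
  qed
qed

text \<open>
  The function \<open>D\<close> below is the defect of the expansion for \<open>w = 1\<close>, with \<open>x\<close> replaced by a complex
  variable. It vanishes on the positive reals, hence on the open half-plane, hence at \<open>w\<close> itself,
  where the expansion in direction \<open>w\<close> at \<open>x = 1\<close> has the same terms except the constant.
\<close>
lemma reg_mellin_rotate:
  assumes "-3 < Re a" "Re a < -2" "Re w \<ge> 0" "w \<noteq> 0"
  shows "reg_mellin a w = w powr (- a - 1) * reg_mellin a 1"
proof -
  define D where "D = (\<lambda>z. expint a z - (- 1 / (a + 1) + z / (a + 2)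
           + z powr (- a - 1) * reg_mellin a 1 - z\<^sup>2 * rem_series a z))"
  have a: "a + 1 \<noteq> 0" "a + 2 \<noteq> 0" using assms by (auto simp: complex_eq_iff)
  have nonpos: "z \<notin> \<real>\<^sub>\<le>\<^sub>0" if "Re z \<ge> 0" "z \<noteq> 0" for z
    using that by (auto simp: complex_nonpos_Reals_iff complex_eq_iff)
  have D_real: "D (of_real x) = 0" if "x > 0" for x
    using expint_expansion[OF assms(1,2), of 1 x] that by (simp add: D_def)
  have hol: "D holomorphic_on {z. Re z > 0}"
    unfolding D_def using a nonpos[OF less_imp_le] assms
    by (intro holomorphic_intros expint_holomorphic rem_series_holomorphic) force+
  have cont: "continuous_on ({z. Re z \<ge> 0} - {0}) D"
    unfolding D_def using a nonpos assms
    by (intro continuous_intros continuous_on_subset[OF expint_continuous]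
        holomorphic_on_imp_continuous_on[OF rem_series_holomorphic]) auto
  have D0: "D z = 0" if "Re z > 0" for z
  proof (rule analytic_continuation[OF hol open_halfspace_Re_gt])
    show "connected {z. 0 < Re z}"
      by (intro convex_connected convex_halfspace_Re_gt)
    show "(1::complex) islimpt (of_real ` {0<..})"
    proof (rule connected_imp_perfect)
      show "connected (complex_of_real ` {0<..})"
        by (intro connected_continuous_image continuous_intros) auto
      show mem1: "(1::complex) \<in> of_real ` {0<..}" by (intro image_eqI[of _ _ 1]) auto
      have mem2: "(2::complex) \<in> of_real ` {0<..}" by (intro image_eqI[of _ _ 2]) auto
      have "(1::complex) \<noteq> 2" by simp
      then show "complex_of_real ` {0<..} \<noteq> {x}" for x
        using mem1 mem2 by (metis singletonD)
    qed
  qed (use that D_real in auto)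
  have "((\<lambda>e. D (w + of_real e)) \<longlongrightarrow> D w) (at_right 0)"
  proof (rule continuous_on_tendsto_compose[OF cont])
    have "((\<lambda>e. w + complex_of_real e) \<longlongrightarrow> w + of_real 0) (at_right 0)"
      by (intro tendsto_intros)
    then show "((\<lambda>e. w + complex_of_real e) \<longlongrightarrow> w) (at_right 0)" by simp
    show "\<forall>\<^sub>F e in at_right 0. w + complex_of_real e \<in> {z. Re z \<ge> 0} - {0}"
      using assms by (intro eventually_at_rightI[of 0 1]) (auto simp: complex_eq_iff)
  qed (use assms in auto)
  moreover have "((\<lambda>e. D (w + of_real e)) \<longlongrightarrow> 0) (at_right 0)"
    by (rule tendsto_eventually) (use D0 assms in \<open>auto intro!: eventually_at_rightI[of 0 1]\<close>)
  ultimately have "D w = 0"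
    by (intro tendsto_unique) auto
  then show ?thesis
    using expint_expansion[OF assms(1-3), of 1] by (simp add: D_def)
qed

lemma reg_mellin_neq_0:
  assumes "-3 < Re a" "Re a < -2" "Re w \<ge> 0" "w \<noteq> 0"
  shows "reg_mellin a w \<noteq> 0"
proof -
  have "a + 3 \<notin> \<int>\<^sub>\<le>\<^sub>0"
    using assms(1) by (auto elim!: nonpos_Ints_cases simp: complex_eq_iff)
  then have "Gamma (a + 3) \<noteq> 0" by (simp add: Gamma_eq_zero_iff)
  then have "reg_mellin a 1 \<noteq> 0" using reg_mellin_1[OF assms(1,2)] by auto
  then show ?thesis using reg_mellin_rotate[OF assms] assms(4) by simp
qed

section \<open>The exponential integral at infinity\<close>

lemma norm_expint_le:
  assumes "Re a < -1" "Re z \<ge> 0"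
  shows "norm (expint a z) \<le> - 1 / (Re a + 1)"
proof -
  have "norm (expint a z) \<le> - (1 powr (Re a + 1)) / (Re a + 1)"
    unfolding expint_def using assms
    by (intro norm_set_integral_Ici_le set_integrable_expint) (auto simp: norm_mult norm_of_real_powr mult_left_le)
  then show ?thesis by simp
qed

text \<open>
  Integration by parts, integrating the exponential. On the imaginary axis the exponential does not decay, and the
  boundary term at infinity vanishes only through the power of \<open>t\<close>.
\<close>
lemma expint_recurrence:
  assumes "Re a < -1" "Re z \<ge> 0" "z \<noteq> 0"
  shows "expint a z = exp (-z) / z + a / z * expint (a - 1) z"
proof -
  define g where "g = (\<lambda>b t. complex_of_real t powr b * exp (- (z * of_real t)))"
  define F where "F = (\<lambda>t. - (1 / z) * g a t)"
  have g: "set_integrable lborel {1..} (g b)" if "Re b < -1" for b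
    unfolding g_def by (rule set_integrable_expint[OF that assms(2)])
  have E: "(LINT t:{1..}|lborel. g b t) = expint b z" for b
    by (simp add: g_def expint_def)
  have i: "set_integrable lborel {1..} (\<lambda>t. g a t - a / z * g (a - 1) t)"
    using assms by (intro set_integral_diff set_integrable_mult_right g) auto
  have dexp: "((\<lambda>t. exp (- (z * complex_of_real t))) has_vector_derivative - z * exp (- (z * complex_of_real t))) (at t)" for t
    by (rule has_vector_derivative_real_field) (auto intro!: derivative_eq_intros)
  have dF: "(F has_vector_derivative g a t - a / z * g (a - 1) t) (at t)" if "t > 0" for t
  proof -
    have "(F has_vector_derivative - (1 / z) * (of_real t powr a * (- z * exp (- (z * complex_of_real t)))
        + a * of_real t powr (a - 1) * exp (- (z * complex_of_real t)))) (at t)"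
      unfolding F_def g_def
      by (intro has_vector_derivative_mult has_vector_derivative_mult_right has_vector_derivative_of_real_powr
          dexp that)
    also have "- (1 / z) * (of_real t powr a * (- z * exp (- (z * complex_of_real t)))
        + a * of_real t powr (a - 1) * exp (- (z * complex_of_real t))) = g a t - a / z * g (a - 1) t"
      using assms(3) by (simp add: g_def field_simps)
    finally show ?thesis .
  qed
  have "(LINT t:{1<..}|lborel. g a t - a / z * g (a - 1) t) = 0 - F 1"
  proof (rule set_integral_FTC_Ioi[where F=F])
    show "continuous_on {1<..} (\<lambda>t. g a t - a / z * g (a - 1) t)"
      unfolding g_def by (intro continuous_intros) (use assms(3) in auto)
    show "set_integrable lborel {1<..} (\<lambda>t. g a t - a / z * g (a - 1) t)"
      by (rule set_integrable_subset[OF i]) auto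
    have "isCont F 1"
      by (rule has_vector_derivative_continuous[OF dF]) simp
    then show "(F \<longlongrightarrow> F 1) (at_right 1)"
      unfolding isCont_def by (rule tendsto_within_subset) auto
    show "(F \<longlongrightarrow> 0) at_top"
    proof (rule Lim_null_comparison)
      show "((\<lambda>s. norm (1 / z) * norm (complex_of_real s powr a)) \<longlongrightarrow> 0) at_top"
        using assms by (intro tendsto_mult_right_zero tendsto_norm_zero tendsto_of_real_powr_at_top) auto
      have "norm (F s) \<le> norm (1 / z) * norm (complex_of_real s powr a)" if "s \<ge> 0" for s
      proof -
        have "norm (exp (- (z * complex_of_real s))) \<le> 1"
          using that assms by simp
        then have "norm (g a s) \<le> norm (complex_of_real s powr a)"
          unfolding g_def norm_mult by (intro mult_left_le) auto
        then show ?thesis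
          unfolding F_def norm_mult norm_minus_cancel by (intro mult_left_mono) auto
      qed
      then show "\<forall>\<^sub>F s in at_top. norm (F s) \<le> norm (1 / z) * norm (complex_of_real s powr a)"
        by (auto intro!: eventually_mono[OF eventually_ge_at_top[of 0]])
    qed
  qed (use dF in auto)
  then have "(LINT t:{1..}|lborel. g a t - a / z * g (a - 1) t) = exp (-z) / z"
    by (simp add: set_integral_Ici_eq_Ioi F_def g_def)
  moreover have "(LINT t:{1..}|lborel. g a t - a / z * g (a - 1) t) = expint a z - a / z * expint (a - 1) z"
    using assms by (simp add: set_integral_diff g E)
  ultimately show ?thesis by (simp add: algebra_simps)
qed

text \<open>
  The recurrence expresses the error by \<open>expint (a - 1) z\<close>; a second use of it shows that this is
  \<open>O(1/|z|)\<close>, not merely bounded.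
\<close>
lemma expint_asymptotic:
  assumes "Re a < -1" "Re z \<ge> 0" "z \<noteq> 0"
  shows "norm (expint a z - exp (-z) / z) \<le> norm a * (1 - norm (a - 1) / (Re a - 1)) / norm z ^ 2"
proof -
  have "norm (expint (a - 1) z) = norm (exp (-z) / z + (a - 1) / z * expint (a - 1 - 1) z)"
    using assms expint_recurrence[of "a - 1" z] by simp
  also have "\<dots> \<le> norm (exp (-z)) / norm z + norm (a - 1) / norm z * norm (expint (a - 1 - 1) z)"
    by (rule order.trans[OF norm_triangle_ineq]) (simp add: norm_mult norm_divide)
  also have "\<dots> \<le> 1 / norm z + norm (a - 1) / norm z * (- 1 / (Re (a - 1 - 1) + 1))"
    using assms by (intro add_mono mult_left_mono divide_right_mono norm_expint_le) auto
  also have "\<dots> = (1 - norm (a - 1) / (Re a - 1)) / norm z"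
    by (simp add: diff_divide_distrib)
  finally have "norm a / norm z * norm (expint (a - 1) z) \<le> norm a / norm z * ((1 - norm (a - 1) / (Re a - 1)) / norm z)"
    by (intro mult_left_mono) auto
  moreover have "norm (expint a z - exp (-z) / z) = norm a / norm z * norm (expint (a - 1) z)"
    using expint_recurrence[OF assms] by (simp add: norm_mult norm_divide)
  ultimately show ?thesis by (simp add: power2_eq_square)
qed

section \<open>Differentiability classes and local Lipschitz continuity\<close>

text \<open>
  Derivatives within \<open>S\<close> are unique at the points of \<open>S\<close> that are not isolated in it, so any explicit
  chain of derivatives must agree with the iterated ones.
\<close>
lemma iter_deriv_on_eq:
  assumes nontriv: "\<And>x. x \<in> S \<Longrightarrow> at x within S \<noteq> bot"
    and h0: "\<And>x. x \<in> S \<Longrightarrow> h 0 x = g x"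
    and step: "\<And>j x. j < k \<Longrightarrow> x \<in> S \<Longrightarrow> (h j has_vector_derivative h (Suc j) x) (at x within S)"
    and "j \<le> k" "x \<in> S"
  shows "iter_deriv_on j S g x = h j x"
  using assms(4,5)
proof (induction j arbitrary: x)
  case (Suc j)
  have "(h j has_vector_derivative h (Suc j) x) (at x within S)"
    using Suc.prems by (intro step) auto
  then have "(iter_deriv_on j S g has_vector_derivative h (Suc j) x) (at x within S)"
    by (rule has_vector_derivative_transform[rotated 2]) (use Suc in auto)
  then show ?case
    using nontriv Suc.prems by (auto intro: vector_derivative_within)
qed (simp add: h0)

lemma Ck_on_if_derivative_chain:
  assumes nontriv: "\<And>x. x \<in> S \<Longrightarrow> at x within S \<noteq> bot"
    and h0: "\<And>x. x \<in> S \<Longrightarrow> h 0 x = g x"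
    and step: "\<And>j x. j < k \<Longrightarrow> x \<in> S \<Longrightarrow> (h j has_vector_derivative h (Suc j) x) (at x within S)"
    and cont: "continuous_on S (h k)"
  shows "Ck_on k S g"
  unfolding Ck_on_def
proof (intro conjI allI impI ballI)
  note eq = iter_deriv_on_eq[where h=h and g=g and k=k, OF nontriv h0 step]
  fix j x assume "j < k" "x \<in> S"
  then have "(iter_deriv_on j S g has_vector_derivative h (Suc j) x) (at x within S)"
    by (intro has_vector_derivative_transform[OF _ _ step]) (auto simp: eq)
  then show "iter_deriv_on j S g differentiable at x within S"
    by (rule differentiableI_vector)
next
  show "continuous_on S (iter_deriv_on k S g)"
    using cont iter_deriv_on_eq[where h=h and g=g and k=k, OF nontriv h0 step]
    by (subst continuous_on_cong[OF refl]) auto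
qed

lemma has_vector_derivative_higher_deriv_of_real:
  assumes "f holomorphic_on A" "open A" "complex_of_real x \<in> A"
  shows "((\<lambda>x. (deriv ^^ j) f (of_real x)) has_vector_derivative (deriv ^^ Suc j) f (of_real x)) (at x within S)"
  by (rule has_vector_derivative_real_field, rule has_field_derivative_higher_deriv[OF assms])

text \<open>
  The complex derivatives of \<open>f\<close>, restricted to the reals, form the chain. This
  covers one-sided derivatives at the end of a half-line as well.
\<close>
lemma Cinf_on_if_holomorphic:
  assumes "f holomorphic_on A" "open A" "\<And>x. x \<in> S \<Longrightarrow> complex_of_real x \<in> A"
    and "\<And>x. x \<in> S \<Longrightarrow> at x within S \<noteq> bot"
    and "\<And>x. x \<in> S \<Longrightarrow> g x = f (of_real x)"
  shows "Cinf_on S g"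
  unfolding Cinf_on_def
proof
  fix k
  show "Ck_on k S g"
  proof (rule Ck_on_if_derivative_chain[where h="\<lambda>j x. (deriv ^^ j) f (of_real x)"])
    show "((\<lambda>x. (deriv ^^ j) f (of_real x)) has_vector_derivative (deriv ^^ Suc j) f (of_real x)) (at x within S)"
      if "x \<in> S" for j x
      by (rule has_vector_derivative_higher_deriv_of_real[OF assms(1,2)]) (use that assms(3) in auto)
    then show "continuous_on S (\<lambda>x. (deriv ^^ k) f (of_real x))"
      by (rule continuous_on_vector_derivative)
  qed (use assms in auto)
qed

text \<open>
  The complex derivative is bounded on closed discs, which are compact and convex.
\<close>
lemma locally_lipschitz_entire:
  assumes "f holomorphic_on UNIV"
  shows "locally_lipschitz (\<lambda>x. f (of_real x))"
  unfolding locally_lipschitz_def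
proof
  fix x :: real
  have df: "(f has_field_derivative deriv f z) (at z)" for z
    using assms by (auto intro: holomorphic_derivI)
  have "deriv f holomorphic_on UNIV" using assms by (intro holomorphic_deriv) auto
  then have "compact (deriv f ` cball (of_real x) 1)"
    by (intro compact_continuous_image holomorphic_on_imp_continuous_on) (auto intro: holomorphic_on_subset)
  then obtain B where B: "B > 0" "\<And>z. z \<in> cball (of_real x) 1 \<Longrightarrow> norm (deriv f z) \<le> B"
    using compact_imp_bounded bounded_pos by (metis image_eqI)
  have "B-lipschitz_on (ball x 1) (\<lambda>x. f (of_real x))"
  proof (rule lipschitz_onI)
    fix y z assume yz: "y \<in> ball x 1" "z \<in> ball x 1"
    have "norm (f (of_real y) - f (of_real z)) \<le> B * norm (complex_of_real y - of_real z)"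
    proof (rule field_differentiable_bound[where S="cball (of_real x) 1"])
      show "(f has_field_derivative deriv f z) (at z within cball (of_real x) 1)" for z
        using df by (rule has_field_derivative_at_within)
    qed (use B yz in \<open>auto simp: dist_of_real less_imp_le\<close>)
    then show "dist (f (of_real y)) (f (of_real z)) \<le> B * dist y z"
      by (simp add: dist_norm flip: of_real_diff)
  qed (use B in auto)
  then show "\<exists>r>0. \<exists>L. L-lipschitz_on (ball x r) (\<lambda>x. f (of_real x))"
    by (intro exI[of _ 1]) auto
qed

lemma locally_lipschitz_imp_continuous:
  assumes "locally_lipschitz f"
  shows "continuous_on S f"
proof -
  have "isCont f x" for x
  proof -
    obtain r L where "r > 0" "L-lipschitz_on (ball x r) f"
      using assms unfolding locally_lipschitz_def by blast
    then show ?thesis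
      by (metis lipschitz_on_continuous_on open_ball centre_in_ball continuous_on_eq_continuous_at)
  qed
  then show ?thesis by (intro continuous_at_imp_continuous_on) auto
qed

lemma locally_lipschitz_add:
  assumes "locally_lipschitz f" "locally_lipschitz g"
  shows "locally_lipschitz (\<lambda>x. f x + g x)"
  unfolding locally_lipschitz_def
proof
  fix x
  obtain r L where r: "r > 0" "L-lipschitz_on (ball x r) f"
    using assms(1) unfolding locally_lipschitz_def by blast
  obtain s M where s: "s > 0" "M-lipschitz_on (ball x s) g"
    using assms(2) unfolding locally_lipschitz_def by blast
  have "(L + M)-lipschitz_on (ball x (min r s)) (\<lambda>x. f x + g x)"
    by (intro lipschitz_on_add lipschitz_on_subset[OF r(2)] lipschitz_on_subset[OF s(2)]) auto
  then show "\<exists>r>0. \<exists>L. L-lipschitz_on (ball x r) (\<lambda>x. f x + g x)"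
    using r s by (intro exI[of _ "min r s"]) auto
qed

section \<open>Powers of the absolute value\<close>

text \<open>
  The homogeneous functions on both half-lines together: \<open>c = 1\<close> gives the even
  power \<open>|x|\<^sup>p\<close> and \<open>c = -1\<close> the odd power \<open>sgn x |x|\<^sup>p\<close>. Differentiation maps the exponent \<open>p\<close> to
  \<open>p - 1\<close> and changes the parity, so one lemma handles both derivatives of \<open>|x|\<^sup>p\<close>.
\<close>
definition even_odd_powr :: "complex \<Rightarrow> complex \<Rightarrow> real \<Rightarrow> complex" where
  "even_odd_powr c p x = (if x > 0 then of_real x powr p else c * of_real (- x) powr p)"

lemma even_odd_powr_1: "even_odd_powr 1 p x = of_real \<bar>x\<bar> powr p"
  by (simp add: even_odd_powr_def)

lemma has_vector_derivative_even_odd_powr: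
  assumes "Re p > 1"
  shows "(even_odd_powr c p has_vector_derivative p * even_odd_powr (- c) (p - 1) x) (at x)"
proof (cases x "0::real" rule: linorder_cases)
  case greater
  have "((\<lambda>x. of_real x powr p) has_vector_derivative p * of_real x powr (p - 1)) (at x)"
    by (rule has_vector_derivative_of_real_powr[OF greater])
  then have "(even_odd_powr c p has_vector_derivative p * of_real x powr (p - 1)) (at x)"
    by (rule has_vector_derivative_transform_within_open[where S="{0<..}"])
       (use greater in \<open>auto simp: even_odd_powr_def\<close>)
  with greater show ?thesis by (simp add: even_odd_powr_def)
next
  case less
  have "(((\<lambda>x. of_real x powr p) \<circ> uminus) has_vector_derivative (- 1) *\<^sub>R (p * of_real (- x) powr (p - 1))) (at x)"
    by (intro vector_diff_chain_at has_vector_derivative_of_real_powr)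
       (use less in \<open>auto intro!: derivative_eq_intros simp flip: has_real_derivative_iff_has_vector_derivative\<close>)
  then have "((\<lambda>x. c * ((\<lambda>x. of_real x powr p) \<circ> uminus) x) has_vector_derivative c * ((- 1) *\<^sub>R (p * of_real (- x) powr (p - 1)))) (at x)"
    by (rule has_vector_derivative_mult_right)
  then have "(even_odd_powr c p has_vector_derivative c * ((- 1) *\<^sub>R (p * of_real (- x) powr (p - 1)))) (at x)"
    by (rule has_vector_derivative_transform_within_open[where S="{..<0}"])
       (use less in \<open>auto simp: even_odd_powr_def\<close>)
  with less show ?thesis by (simp add: even_odd_powr_def mult_ac)
next
  case equal
  have "(even_odd_powr c p has_derivative (\<lambda>_. 0)) (at 0)"
    unfolding has_derivative_at
  proof
    \<comment> \<open>The constant \<open>1 + |c|\<close> dominates the coefficients \<open>1\<close> and \<open>c\<close> of both branches.\<close>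
    have "((\<lambda>h. (1 + norm c) * \<bar>h\<bar> powr (Re p - 1)) \<longlongrightarrow> (1 + norm c) * \<bar>0\<bar> powr (Re p - 1)) (at (0::real))"
      using assms by (intro tendsto_intros) auto
    then have lim: "((\<lambda>h. (1 + norm c) * \<bar>h\<bar> powr (Re p - 1)) \<longlongrightarrow> 0) (at (0::real))" by simp
    show "((\<lambda>h. norm (even_odd_powr c p (0 + h) - even_odd_powr c p 0 - 0) / norm h) \<longlongrightarrow> 0) (at 0)"
    proof (rule Lim_null_comparison[OF _ lim])
      have "norm (even_odd_powr c p h) / \<bar>h\<bar> \<le> (1 + norm c) * \<bar>h\<bar> powr (Re p - 1)" if "h \<noteq> 0" for h
      proof -
        have "norm (even_odd_powr c p h) \<le> (1 + norm c) * \<bar>h\<bar> powr Re p"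
        proof (cases "h > 0")
          case True
          then show ?thesis by (simp add: even_odd_powr_def norm_of_real_powr algebra_simps)
        next
          case False
          then have "norm (complex_of_real (- h) powr p) = \<bar>h\<bar> powr Re p"
            using norm_of_real_powr[of "- h" p] by (simp del: of_real_minus)
          with False show ?thesis
            by (simp add: even_odd_powr_def norm_mult algebra_simps del: of_real_minus)
        qed
        then show ?thesis
          using that by (simp add: powr_diff field_simps)
      qed
      then show "\<forall>\<^sub>F h in at 0. norm (norm (even_odd_powr c p (0 + h) - even_odd_powr c p 0 - 0) / norm h) \<le> (1 + norm c) * \<bar>h\<bar> powr (Re p - 1)"
        by (auto simp: eventually_at_filter even_odd_powr_def[of c p 0])
    qed
  qed simp
  with equal show ?thesis by (simp add: has_vector_derivative_def even_odd_powr_def)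
qed

text \<open>
  For \<open>Re q = 1\<close> the derivative of \<open>x\<^sup>q\<close> on the positive reals has constant modulus \<open>|q|\<close>. The
  endpoint \<open>0\<close>, where the function is not differentiable, is handled by \<open>|q| \<ge> Re q = 1\<close>, and negative arguments by
  the reverse triangle inequality.
\<close>
lemma lipschitz_abs_powr:
  assumes "Re q = 1"
  shows "norm (complex_of_real \<bar>x\<bar> powr q - of_real \<bar>y\<bar> powr q) \<le> norm q * \<bar>x - y\<bar>"
proof -
  have q: "norm q \<ge> 1" using complex_Re_le_cmod[of q] assms by simp
  have *: "norm (complex_of_real x powr q - of_real y powr q) \<le> norm q * (y - x)" if "0 \<le> x" "x \<le> y" for x y
  proof (cases "x = 0")
    case True
    have "norm (complex_of_real y powr q) = y" using that True assms by (simp add: norm_of_real_powr)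
    also have "y \<le> norm q * y" using q that True mult_right_mono[of 1 "norm q" y] by simp
    finally show ?thesis using True by simp
  next
    case False
    have "norm ((\<lambda>x. complex_of_real x powr q) x - (\<lambda>x. complex_of_real x powr q) y) \<le> norm q * norm (x - y)"
    proof (rule differentiable_bound[where S="{x..y}"])
      show "((\<lambda>x. complex_of_real x powr q) has_derivative (\<lambda>h. h *\<^sub>R (q * of_real t powr (q - 1)))) (at t within {x..y})"
        if "t \<in> {x..y}" for t
        using has_vector_derivative_of_real_powr[of t q] that \<open>0 \<le> x\<close> False by (simp add: has_vector_derivative_def)
      show "onorm (\<lambda>h. h *\<^sub>R (q * complex_of_real t powr (q - 1))) \<le> norm q" if "t \<in> {x..y}" for t
        using that \<open>0 \<le> x\<close> False assms
        by (intro onorm_le) (auto simp: norm_mult norm_of_real_powr)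
    qed (use that in auto)
    then show ?thesis using that by simp
  qed
  have "norm (complex_of_real \<bar>x\<bar> powr q - of_real \<bar>y\<bar> powr q) \<le> norm q * \<bar>\<bar>x\<bar> - \<bar>y\<bar>\<bar>"
    using *[of "\<bar>x\<bar>" "\<bar>y\<bar>"] *[of "\<bar>y\<bar>" "\<bar>x\<bar>"] by (cases "\<bar>x\<bar> \<le> \<bar>y\<bar>") (auto simp: norm_minus_commute)
  also have "\<dots> \<le> norm q * \<bar>x - y\<bar>"
    by (intro mult_left_mono) auto
  finally show ?thesis .
qed

lemma locally_lipschitz_abs_powr:
  assumes "Re q = 1"
  shows "locally_lipschitz (\<lambda>x. c * of_real \<bar>x\<bar> powr q)"
proof -
  have "(norm c * norm q)-lipschitz_on S (\<lambda>x. c * of_real \<bar>x\<bar> powr q)" for S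
    using mult_left_mono[OF lipschitz_abs_powr[OF assms], of "norm c"]
    by (intro lipschitz_onI) (auto simp: dist_norm norm_mult mult.assoc simp flip: right_diff_distrib)
  then show ?thesis unfolding locally_lipschitz_def by (meson zero_less_one)
qed

text \<open>
  An even function can only have derivative \<open>0\<close> at \<open>0\<close>, but the difference quotients have modulus \<open>1\<close>.
\<close>
lemma abs_powr_not_differentiable:
  assumes "Re q = 1"
  shows "\<not> (\<lambda>x. complex_of_real \<bar>x\<bar> powr q) differentiable (at 0)"
proof
  let ?g = "\<lambda>x. complex_of_real \<bar>x\<bar> powr q"
  assume "?g differentiable (at 0)"
  then obtain d where d: "(?g has_vector_derivative d) (at 0)"
    using vector_derivative_works by blast
  have "((?g \<circ> uminus) has_vector_derivative (- 1) *\<^sub>R d) (at 0)"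
    by (intro vector_diff_chain_at)
       (use d in \<open>auto intro!: derivative_eq_intros simp flip: has_real_derivative_iff_has_vector_derivative\<close>)
  then have "(?g has_vector_derivative - d) (at 0)"
    by (simp add: o_def)
  then have "- d = d"
    using d by (rule vector_derivative_unique_at)
  then have "d = 0" by simp
  then have "(?g has_derivative (\<lambda>_. 0)) (at 0)"
    using d by (simp add: has_vector_derivative_def)
  then have "((\<lambda>h. norm (?g (0 + h) - ?g 0 - 0) / norm h) \<longlongrightarrow> 0) (at 0)"
    unfolding has_derivative_at by blast
  moreover have "((\<lambda>h. norm (?g (0 + h) - ?g 0 - 0) / norm h) \<longlongrightarrow> 1) (at 0)"
    by (rule tendsto_eventually) (auto simp: eventually_at_filter norm_of_real_powr assms)
  ultimately have "(0::real) = 1"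
    by (intro tendsto_unique) auto
  then show False by simp
qed

section \<open>The oscillatory integral\<close>

lemma frakF_eq_expint:
  "frakF \<alpha> \<eta> = expint (-5/2 - \<i> * of_real \<alpha>) (- \<i> * of_real (\<eta>\<^sup>2))"
  by (simp add: frakF_def expint_def mult.assoc)

lemma coeffC_eq_reg_mellin:
  "coeffC \<alpha> = reg_mellin (-5/2 - \<i> * of_real \<alpha>) (- \<i>)"
  by (simp add: coeffC_def reg_mellin_def set_integral_Ici_eq_Ioi)

text \<open>
  The entire part of the expansion in \<open>\<eta>\<close>. For \<open>w = -i\<close> and \<open>x = \<eta>\<^sup>2\<close> the factor
  \<open>-(w x)\<^sup>2\<close> in front of the remainder series is \<open>\<eta>\<close> to the fourth power with a positive sign.
\<close>
definition regular_part :: "real \<Rightarrow> complex \<Rightarrow> complex" where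
  "regular_part \<alpha> z =
     1 / (3/2 + \<i> * of_real \<alpha>) + \<i> / (1/2 + \<i> * of_real \<alpha>) * z\<^sup>2
     + z ^ 4 * rem_series (-5/2 - \<i> * of_real \<alpha>) (- \<i> * z\<^sup>2)"

lemma regular_part_holomorphic: "regular_part \<alpha> holomorphic_on S"
proof -
  have "rem_series (-5/2 - \<i> * of_real \<alpha>) \<circ> (\<lambda>z. - \<i> * z\<^sup>2) holomorphic_on S"
    by (rule holomorphic_on_compose[OF _ rem_series_holomorphic]) (auto intro!: holomorphic_intros)
  moreover have "1/2 + \<i> * complex_of_real \<alpha> \<noteq> 0" "3/2 + \<i> * complex_of_real \<alpha> \<noteq> 0"
    by (auto simp: complex_eq_iff)
  ultimately show ?thesis
    unfolding regular_part_def o_def by (intro holomorphic_intros)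
qed

text \<open>
  At \<open>\<eta> = 0\<close>, where the scaling argument is void, both sides are \<open>\<integral>\<^sub>1\<^sup>\<infinity> t\<^sup>a dt\<close>, since \<open>0\<close> to any
  power is \<open>0\<close>. Elsewhere \<open>|\<eta>|\<close> to the power \<open>3 + 2i\<alpha>\<close> is the scale \<open>x = \<eta>\<^sup>2\<close> to the power \<open>-a-1\<close>.
\<close>
lemma frakF_expansion:
  "frakF \<alpha> \<eta> = regular_part \<alpha> (of_real \<eta>)
     + coeffC \<alpha> * of_real \<bar>\<eta>\<bar> powr (3 + 2 * \<i> * of_real \<alpha>)"
proof -
  let ?a = "-5/2 - \<i> * complex_of_real \<alpha>"
  have c0: "- 1 / (?a + 1) = 1 / (3/2 + \<i> * complex_of_real \<alpha>)"
  proof -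
    have "?a + 1 = - (3/2 + \<i> * complex_of_real \<alpha>)" by simp
    then show ?thesis by (simp only: divide_minus_right minus_divide_left minus_minus)
  qed
  have c1: "- \<i> / (?a + 2) = \<i> / (1/2 + \<i> * complex_of_real \<alpha>)"
  proof -
    have "?a + 2 = - (1/2 + \<i> * complex_of_real \<alpha>)" by simp
    then show ?thesis by (simp only: divide_minus_right minus_divide_left minus_minus)
  qed
  show ?thesis
  proof (cases "\<eta> = 0")
    case True
    have "frakF \<alpha> 0 = (LINT t:{1..}|lborel. complex_of_real t powr ?a)"
      by (simp add: frakF_def)
    also have "\<dots> = - 1 / (?a + 1)"
      by (rule set_integral_of_real_powr_Ici) simp
    finally show ?thesis
      using c0 True by (simp add: regular_part_def)
  next
    case False
    have "complex_of_real (\<eta>\<^sup>2) powr (- ?a - 1) = (of_real \<bar>\<eta>\<bar> * of_real \<bar>\<eta>\<bar>) powr (- ?a - 1)"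
      by (simp add: power2_eq_square flip: of_real_mult)
    also have "\<dots> = of_real \<bar>\<eta>\<bar> powr (- ?a - 1) * of_real \<bar>\<eta>\<bar> powr (- ?a - 1)"
      by (rule powr_times_real) auto
    also have "\<dots> = of_real \<bar>\<eta>\<bar> powr ((- ?a - 1) + (- ?a - 1))"
      using False by (subst of_real_powr_add) auto
    also have "(- ?a - 1) + (- ?a - 1) = 3 + 2 * \<i> * of_real \<alpha>"
      by (simp add: algebra_simps)
    finally have pw: "complex_of_real (\<eta>\<^sup>2) powr (- ?a - 1) = of_real \<bar>\<eta>\<bar> powr (3 + 2 * \<i> * of_real \<alpha>)" .
    have "frakF \<alpha> \<eta> = - 1 / (?a + 1) + (- \<i>) * of_real (\<eta>\<^sup>2) / (?a + 2)
           + of_real (\<eta>\<^sup>2) powr (- ?a - 1) * reg_mellin ?a (- \<i>)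
           - ((- \<i>) * of_real (\<eta>\<^sup>2))\<^sup>2 * rem_series ?a ((- \<i>) * of_real (\<eta>\<^sup>2))"
      unfolding frakF_eq_expint by (rule expint_expansion) (use False in auto)
    also have "(- \<i>) * of_real (\<eta>\<^sup>2) / (?a + 2) = (- \<i>) / (?a + 2) * of_real (\<eta>\<^sup>2)"
      by simp
    also have "((- \<i>) * complex_of_real (\<eta>\<^sup>2))\<^sup>2 = - (of_real \<eta> ^ 4)"
      by (simp add: power_mult_distrib flip: power_mult)
    finally show ?thesis
      unfolding pw c0 c1 coeffC_eq_reg_mellin regular_part_def by (simp add: mult_ac)
  qed
qed

lemma coeffC_neq_0: "coeffC \<alpha> \<noteq> 0"
  unfolding coeffC_eq_reg_mellin by (rule reg_mellin_neq_0) auto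

text \<open>
  The function with its first two derivatives, for \<open>j = 0, 1, 2\<close>; larger values of \<open>j\<close> carry no
  meaning.
\<close>
definition frakF_chain :: "real \<Rightarrow> nat \<Rightarrow> real \<Rightarrow> complex" where
  "frakF_chain \<alpha> j \<eta> = (deriv ^^ j) (regular_part \<alpha>) (of_real \<eta>) + coeffC \<alpha> *
     (let p = 3 + 2 * \<i> * of_real \<alpha> in
      if j = 0 then even_odd_powr 1 p \<eta>
      else if j = 1 then p * even_odd_powr (- 1) (p - 1) \<eta>
      else p * (p - 1) * even_odd_powr 1 (p - 2) \<eta>)"

lemma frakF_chain_0: "frakF_chain \<alpha> 0 \<eta> = frakF \<alpha> \<eta>"
  by (simp add: frakF_chain_def frakF_expansion even_odd_powr_1)

lemma frakF_chain_2:
  "frakF_chain \<alpha> 2 \<eta> = (deriv ^^ 2) (regular_part \<alpha>) (of_real \<eta>)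
     + (coeffC \<alpha> * ((3 + 2 * \<i> * of_real \<alpha>) * (2 + 2 * \<i> * of_real \<alpha>)))
       * of_real \<bar>\<eta>\<bar> powr (1 + 2 * \<i> * of_real \<alpha>)"
  by (simp add: frakF_chain_def Let_def even_odd_powr_1 mult.assoc)

text \<open>
  The exponents of the power being differentiated have real parts \<open>3\<close> and \<open>2\<close>, so the power rule
  holds at \<open>0\<close> as well. The next exponent has real part \<open>1\<close>, which is where this stops.
\<close>
lemma frakF_chain_step:
  assumes "j < 2"
  shows "(frakF_chain \<alpha> j has_vector_derivative frakF_chain \<alpha> (Suc j) \<eta>) (at \<eta>)"
proof -
  let ?p = "3 + 2 * \<i> * complex_of_real \<alpha>"
  have reg: "((\<lambda>x. (deriv ^^ j) (regular_part \<alpha>) (of_real x)) has_vector_derivative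
       (deriv ^^ Suc j) (regular_part \<alpha>) (of_real \<eta>)) (at \<eta>)" for j
    by (rule has_vector_derivative_higher_deriv_of_real[OF regular_part_holomorphic open_UNIV]) simp
  consider "j = 0" | "j = 1" using assms by linarith
  then show ?thesis
  proof cases
    case 1
    have "(even_odd_powr 1 ?p has_vector_derivative ?p * even_odd_powr (- 1) (?p - 1) \<eta>) (at \<eta>)"
      by (rule has_vector_derivative_even_odd_powr) simp
    then show ?thesis
      unfolding frakF_chain_def Let_def 1
      using reg[of 0] by (auto intro!: has_vector_derivative_add has_vector_derivative_mult_right)
  next
    case 2
    have "(even_odd_powr (- 1) (?p - 1) has_vector_derivative (?p - 1) * even_odd_powr (- (- 1)) (?p - 1 - 1) \<eta>) (at \<eta>)"
      by (rule has_vector_derivative_even_odd_powr) simp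
    then have "((\<lambda>x. ?p * even_odd_powr (- 1) (?p - 1) x) has_vector_derivative
        ?p * ((?p - 1) * even_odd_powr (- (- 1)) (?p - 1 - 1) \<eta>)) (at \<eta>)"
      by (rule has_vector_derivative_mult_right)
    also have "?p * ((?p - 1) * even_odd_powr (- (- 1)) (?p - 1 - 1) \<eta>) = ?p * (?p - 1) * even_odd_powr 1 (?p - 2) \<eta>"
      by (simp add: mult.assoc)
    finally have "((\<lambda>x. (deriv ^^ 1) (regular_part \<alpha>) (of_real x) + coeffC \<alpha> * (?p * even_odd_powr (- 1) (?p - 1) x)) has_vector_derivative
       (deriv ^^ Suc 1) (regular_part \<alpha>) (of_real \<eta>) + coeffC \<alpha> * (?p * (?p - 1) * even_odd_powr 1 (?p - 2) \<eta>)) (at \<eta>)"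
      by (intro has_vector_derivative_add has_vector_derivative_mult_right reg)
    then show ?thesis
      unfolding frakF_chain_def Let_def 2 by simp
  qed
qed

lemma frakF_second_deriv: "iter_deriv_on 2 UNIV (frakF \<alpha>) = frakF_chain \<alpha> 2"
  by (intro ext iter_deriv_on_eq[where h="frakF_chain \<alpha>" and k=2])
     (auto simp: frakF_chain_0 frakF_chain_step)

lemma frakF_second_deriv_lipschitz: "locally_lipschitz (frakF_chain \<alpha> 2)"
proof -
  have "locally_lipschitz (\<lambda>x. (deriv ^^ 2) (regular_part \<alpha>) (of_real x))"
    by (intro locally_lipschitz_entire holomorphic_higher_deriv regular_part_holomorphic) auto
  then show ?thesis
    unfolding frakF_chain_2[abs_def]
    by (intro locally_lipschitz_add locally_lipschitz_abs_powr) auto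
qed

lemma frakF_C21_loc: "C21_loc (frakF \<alpha>)"
  unfolding C21_loc_def frakF_second_deriv
proof
  show "Ck_on 2 UNIV (frakF \<alpha>)"
    by (rule Ck_on_if_derivative_chain[where h="frakF_chain \<alpha>"])
       (auto simp: frakF_chain_0 frakF_chain_step
         intro: locally_lipschitz_imp_continuous frakF_second_deriv_lipschitz)
qed (rule frakF_second_deriv_lipschitz)

text \<open>
  Solving for the singular part, a third derivative would make \<open>|x|\<close> to the power \<open>1 + 2i\<alpha>\<close>
  differentiable at \<open>0\<close>.
\<close>
lemma frakF_not_C3: "\<not> Ck_on 3 UNIV (frakF \<alpha>)"
proof
  let ?q = "1 + 2 * \<i> * complex_of_real \<alpha>"
  let ?c = "coeffC \<alpha> * ((3 + 2 * \<i> * of_real \<alpha>) * (2 + 2 * \<i> * of_real \<alpha>))"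
  have c: "?c \<noteq> 0"
    using coeffC_neq_0 by (auto simp: complex_eq_iff[of "3 + _"] complex_eq_iff[of "2 + _"])
  assume "Ck_on 3 UNIV (frakF \<alpha>)"
  then have "frakF_chain \<alpha> 2 differentiable (at 0)"
    unfolding Ck_on_def frakF_second_deriv[symmetric] by simp
  moreover have "(\<lambda>x. (deriv ^^ 2) (regular_part \<alpha>) (of_real x)) differentiable (at 0)"
    by (rule differentiableI_vector[OF has_vector_derivative_higher_deriv_of_real[OF regular_part_holomorphic open_UNIV]]) simp
  ultimately have "(\<lambda>x. (1 / ?c) * (frakF_chain \<alpha> 2 x - (deriv ^^ 2) (regular_part \<alpha>) (of_real x))) differentiable (at 0)"
    by (intro differentiable_mult differentiable_diff) auto
  also have "(\<lambda>x. (1 / ?c) * (frakF_chain \<alpha> 2 x - (deriv ^^ 2) (regular_part \<alpha>) (of_real x)))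
      = (\<lambda>x. of_real \<bar>x\<bar> powr ?q)"
    unfolding frakF_chain_2 using c by (simp add: fun_eq_iff)
  finally show False
    using abs_powr_not_differentiable[of ?q] by simp
qed

text \<open>
  Writing \<open>|x|\<close> as a root of \<open>z\<^sup>2\<close> gives a single holomorphic extension on both half-planes at once:
  \<open>z\<^sup>2\<close> avoids the branch cut of the power as long as \<open>Re z \<noteq> 0\<close>.
\<close>
lemma frakF_Cinf_off_0: "Cinf_on (UNIV - {0}) (frakF \<alpha>)"
proof (rule Cinf_on_if_holomorphic[where A="{z. Re z \<noteq> 0}" and
      f="\<lambda>z. regular_part \<alpha> z + coeffC \<alpha> * (z\<^sup>2) powr (3/2 + \<i> * of_real \<alpha>)"])
  have "z\<^sup>2 \<notin> \<real>\<^sub>\<le>\<^sub>0" if "Re z \<noteq> 0" for z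
    using that by (auto simp: complex_nonpos_Reals_iff power2_eq_square mult_le_0_iff)
  then show "(\<lambda>z. regular_part \<alpha> z + coeffC \<alpha> * (z\<^sup>2) powr (3/2 + \<i> * of_real \<alpha>)) holomorphic_on {z. Re z \<noteq> 0}"
    by (intro holomorphic_intros regular_part_holomorphic) auto
  have "open {z. Re z < 0}" "open {z. Re z > 0}"
    by (rule open_halfspace_Re_lt open_halfspace_Re_gt)+
  then have "open ({z. Re z < 0} \<union> {z. Re z > 0})" by (rule open_Un)
  also have "{z. Re z < 0} \<union> {z. Re z > 0} = {z. Re z \<noteq> 0}" by auto
  finally show "open {z. Re z \<noteq> 0}" .
  show "at x within UNIV - {0} \<noteq> bot" if "x \<in> UNIV - {0}" for x :: real
  proof -
    have "at x within UNIV - {0} = at x" using that by (intro at_within_open) auto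
    then show ?thesis by simp
  qed
  show "frakF \<alpha> x = regular_part \<alpha> (of_real x) + coeffC \<alpha> * ((of_real x)\<^sup>2) powr (3/2 + \<i> * of_real \<alpha>)"
    if "x \<in> UNIV - {0}" for x
  proof -
    have "((complex_of_real x)\<^sup>2) powr (3/2 + \<i> * of_real \<alpha>)
        = (of_real \<bar>x\<bar> * of_real \<bar>x\<bar>) powr (3/2 + \<i> * of_real \<alpha>)"
      by (simp add: power2_eq_square flip: of_real_mult)
    also have "\<dots> = of_real \<bar>x\<bar> powr (3/2 + \<i> * of_real \<alpha>) * of_real \<bar>x\<bar> powr (3/2 + \<i> * of_real \<alpha>)"
      by (rule powr_times_real) auto
    also have "\<dots> = of_real \<bar>x\<bar> powr (3 + 2 * \<i> * of_real \<alpha>)"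
      using that by (subst of_real_powr_add[symmetric]) (auto simp: algebra_simps)
    finally show ?thesis by (simp add: frakF_expansion)
  qed
qed auto

lemma Cinf_remainder: "Cinf_on {0..} (\<lambda>x. rem_series (-5/2 - \<i> * of_real \<alpha>) (- \<i> * of_real x))"
proof (rule Cinf_on_if_holomorphic[where A=UNIV and f="\<lambda>z. rem_series (-5/2 - \<i> * of_real \<alpha>) (- \<i> * z)"])
  have "rem_series (-5/2 - \<i> * of_real \<alpha>) \<circ> (\<lambda>z. - \<i> * z) holomorphic_on UNIV"
    by (rule holomorphic_on_compose[OF _ rem_series_holomorphic]) (auto intro!: holomorphic_intros)
  then show "(\<lambda>z. rem_series (-5/2 - \<i> * of_real \<alpha>) (- \<i> * z)) holomorphic_on UNIV"
    by (simp add: o_def)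
  show "at x within {0..} \<noteq> bot" if "x \<in> {0..}" for x :: real
  proof -
    have "at_right x \<le> at x within {0..}" using that by (intro at_le) auto
    then show ?thesis by (metis bot.extremum_uniqueI trivial_limit_at_right_real)
  qed
qed auto

lemma frakF_asymptotic:
  "(\<lambda>\<eta> :: real. norm (frakF \<alpha> \<eta> - \<i> * exp (\<i> * of_real (\<eta>\<^sup>2)) / of_real (\<eta>\<^sup>2)))
       \<in> O[at_infinity](\<lambda>\<eta>. \<bar>\<eta>\<bar> powi (-4))"
proof -
  let ?a = "-5/2 - \<i> * complex_of_real \<alpha>"
  define B where "B = norm ?a * (1 - norm (?a - 1) / (Re ?a - 1))"
  have "norm (frakF \<alpha> \<eta> - \<i> * exp (\<i> * of_real (\<eta>\<^sup>2)) / of_real (\<eta>\<^sup>2)) \<le> B * \<bar>\<eta>\<bar> powi (-4)"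
    if "\<eta> \<noteq> 0" for \<eta>
  proof -
    have "exp (- (- \<i> * of_real (\<eta>\<^sup>2))) / (- \<i> * of_real (\<eta>\<^sup>2)) = \<i> * exp (\<i> * of_real (\<eta>\<^sup>2)) / of_real (\<eta>\<^sup>2)"
      using that by (simp add: field_simps)
    then have "norm (frakF \<alpha> \<eta> - \<i> * exp (\<i> * of_real (\<eta>\<^sup>2)) / of_real (\<eta>\<^sup>2))
        = norm (expint ?a (- \<i> * of_real (\<eta>\<^sup>2)) - exp (- (- \<i> * of_real (\<eta>\<^sup>2))) / (- \<i> * of_real (\<eta>\<^sup>2)))"
      by (simp only: frakF_eq_expint)
    also have "\<dots> \<le> B / norm (- \<i> * complex_of_real (\<eta>\<^sup>2)) ^ 2"
      unfolding B_def by (rule expint_asymptotic) (use that in auto)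
    also have "norm (- \<i> * complex_of_real (\<eta>\<^sup>2)) ^ 2 = \<bar>\<eta>\<bar> ^ 4"
      by (simp add: norm_mult norm_power flip: power_mult)
    finally show ?thesis by (simp add: power_int_minus divide_inverse)
  qed
  then have "\<forall>\<^sub>F \<eta> in at_infinity. norm (norm (frakF \<alpha> \<eta> - \<i> * exp (\<i> * of_real (\<eta>\<^sup>2)) / of_real (\<eta>\<^sup>2)))
      \<le> B * norm (\<bar>\<eta>\<bar> powi (-4))"
    unfolding eventually_at_infinity by (intro exI[of _ 1]) (auto simp: power_int_abs)
  then show ?thesis by (rule bigoI)
qed

theorem proposition4p9:
  fixes \<alpha> :: real
  shows
    "C21_loc (frakF \<alpha>) \<and>
     Cinf_on (UNIV - {0}) (frakF \<alpha>) \<and>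
     \<not> Ck_on 3 UNIV (frakF \<alpha>) \<and>
     coeffC \<alpha> \<noteq> 0 \<and>
     (\<exists>G :: real \<Rightarrow> complex. Cinf_on {0..} G \<and>
        (\<forall>\<^sub>F \<eta> :: real in nhds 0.
           frakF \<alpha> \<eta> =
             1 / (3/2 + \<i> * of_real \<alpha>) +
             \<i> / (1/2 + \<i> * of_real \<alpha>) * of_real (\<eta>\<^sup>2) +
             coeffC \<alpha> * complex_of_real \<bar>\<eta>\<bar> powr (3 + 2 * \<i> * of_real \<alpha>) +
             of_real (\<eta> ^ 4) * G (\<eta>\<^sup>2))) \<and>
     (\<lambda>\<eta> :: real. norm (frakF \<alpha> \<eta> - \<i> * exp (\<i> * of_real (\<eta>\<^sup>2)) / of_real (\<eta>\<^sup>2)))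
       \<in> O[at_infinity](\<lambda>\<eta>. \<bar>\<eta>\<bar> powi (-4))"
proof (intro conjI exI[of _ "\<lambda>x. rem_series (-5/2 - \<i> * of_real \<alpha>) (- \<i> * of_real x)"])
  show "\<forall>\<^sub>F \<eta> :: real in nhds 0.
           frakF \<alpha> \<eta> =
             1 / (3/2 + \<i> * of_real \<alpha>) +
             \<i> / (1/2 + \<i> * of_real \<alpha>) * of_real (\<eta>\<^sup>2) +
             coeffC \<alpha> * complex_of_real \<bar>\<eta>\<bar> powr (3 + 2 * \<i> * of_real \<alpha>) +
             of_real (\<eta> ^ 4) * rem_series (-5/2 - \<i> * of_real \<alpha>) (- \<i> * of_real (\<eta>\<^sup>2))"
    by (simp add: frakF_expansion regular_part_def)
qed (rule frakF_C21_loc frakF_Cinf_off_0 frakF_not_C3 coeffC_neq_0 Cinf_remainder frakF_asymptotic)+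

end
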